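(* Consider a one-dimensional Lévy process with Lévy–Khinchin exponent $\varPsi=\theta+i\omega$ ($\theta=\operatorname{Re}\varPsi$, $\omega=\operatorname{Im}\varPsi$), Gaussian coefficient $a$ and Lévy measure $\nu$. Suppose that $\nu$ has a density, $\nu(dx)=\xi(x)\,dx$, and write $\xi_\pm(x):=\xi(\pm x)$ for $x\ge0$. Suppose, in addition, that $a=0$ and that there exist a constant $\alpha\in(1,2)$ and slowly varying functions $K_+$ and $K_-$ at $0$ such that the limit $$k:=\lim_{x\to0+}\frac{K_-(x)}{K_+(x)}\in[0,\infty]$$ exists and $$\xi_\pm(x)\sim x^{-\alpha-1}K_\pm(x)\qquad\text{as }x\to0+ .$$ Then $$\theta(\lambda)\sim c_\theta\lambda^\alpha L(\lambda),\qquad\omega(\lambda)\sim c_\omega\lambda^\alpha L(\lambda)\qquad\text{as }\lambda\to\infty,$$ where $$c_\theta=\pi C_{\alpha+1},\qquad c_\omega=\frac{1-k}{1+k}\cdot\frac{\pi C_\alpha}{\alpha}$$ (with $\frac{1-k}{1+k}:=-1$ if $k=\infty$), and $L$ is the slowly varying function at $\infty$ given by $$L(\lambda)=K_+(\lambda^{-1})+K_-(\lambda^{-1}),$$ which satisfies, as $\lambda\to\infty$, $L(\lambda)\sim(1+k)K_+(\lambda^{-1})$ if $k\in[0,\infty)$ and $L(\lambda)\sim K_-(\lambda^{-1})$ if $k=\infty$.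
   Context: Lévy–Khinchin exponent: for a one-dimensional Lévy process $X$ starting at $0$, $$\varPsi(\lambda):=-\log\mathbb{E}[e^{i\lambda X_1}]=a\lambda^2+ib\lambda+\int_{\mathbb{R}}\left(1-e^{i\lambda x}+i\lambda x\,1_{\{|x|<1\}}\right)\nu(dx),\quad\lambda\in\mathbb{R},$$ where $a\ge0$ is the Gaussian coefficient, $b\in\mathbb{R}$, and $\nu$ is the Lévy measure (a measure on $\mathbb{R}$ with $\nu(\{0\})=0$ and $\int_{\mathbb{R}}(x^2\wedge1)\,\nu(dx)<\infty$). Thus $$\theta(\lambda)=a\lambda^2+\int_{\mathbb{R}}(1-\cos\lambda x)\,\nu(dx),\qquad \omega(\lambda)=b\lambda+\int_{\mathbb{R}}\left(\lambda x\,1_{\{|x|<1\}}-\sin\lambda x\right)\nu(dx).$$ The constants $C_\gamma$ are defined for $\gamma\in(1,3)$ by $$C_\gamma:=\frac1\pi\int_0^\infty\frac{1-\cos x}{x^\gamma}\,dx=\frac{1}{2\Gamma(\gamma)\sin\frac{\pi(\gamma-1)}{2}} .$$ A function $L:(0,\infty)\to[0,\infty)$ is slowly varying at $p$, where $p=0$ or $p=\infty$, if $L(cx)/L(x)\to1$ as $x\to p$ for all $c>0$. Convention on $\sim$: for a constant $c\in\mathbb{R}$, possibly $c=0$, "$f\sim c\,g$" means $f/g\to c$ in the indicated limit. *)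

theory Defs
  imports "HOL-Probability.Probability"
begin

text \<open>One-dimensional Levy processes started at 0, with time set \<open>{0..}\<close>
  (the values \<open>X t\<close> for \<open>t < 0\<close> are irrelevant).\<close>

definition cadlag :: "(real \<Rightarrow> real) \<Rightarrow> bool" where
  "cadlag f \<longleftrightarrow>
     (\<forall>t\<ge>0. (f \<longlongrightarrow> f t) (at_right t)) \<and> (\<forall>t>0. \<exists>l. (f \<longlongrightarrow> l) (at_left t))"

locale levy_process = prob_space M for M :: "'a measure" +
  fixes X :: "real \<Rightarrow> 'a \<Rightarrow> real"
  assumes random_variable: "0 \<le> t \<Longrightarrow> X t \<in> borel_measurable M"
    and start: "AE w in M. X 0 w = 0"
    and indep_increments:
      "0 \<le> s 0 \<Longrightarrow> (\<And>i. i < n \<Longrightarrow> s i \<le> s (Suc i)) \<Longrightarrow>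
        indep_vars (\<lambda>_. borel) (\<lambda>i w. X (s (Suc i)) w - X (s i) w) {..<n::nat}"
    and stationary_increments:
      "0 \<le> t \<Longrightarrow> 0 \<le> h \<Longrightarrow>
        distr M borel (\<lambda>w. X (t + h) w - X t w) = distr M borel (X h)"
    and cadlag_paths: "AE w in M. cadlag (\<lambda>t. X t w)"

definition levy_measure :: "real measure \<Rightarrow> bool" where
  "levy_measure \<nu> \<longleftrightarrow>
     sets \<nu> = sets borel \<and> emeasure \<nu> {0} = 0 \<and> (\<integral>\<^sup>+x. ennreal (min (x\<^sup>2) 1) \<partial>\<nu>) < \<infinity>"

text \<open>\<open>\<Psi>\<close> is the branch of \<open>-log E[exp(i t X\<^sub>1)]\<close> given by the Levy--Khinchin formula, so the
  defining relation to the process is stated in exponentiated form; the principal logarithm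
  would in general be the wrong branch.\<close>

definition levy_khinchin_exponent ::
  "'a measure \<Rightarrow> (real \<Rightarrow> 'a \<Rightarrow> real) \<Rightarrow> real \<Rightarrow> real \<Rightarrow> real measure \<Rightarrow> (real \<Rightarrow> complex) \<Rightarrow> bool"
  where
  "levy_khinchin_exponent M X a b \<nu> \<Psi> \<longleftrightarrow>
     0 \<le> a \<and> levy_measure \<nu> \<and>
     (\<forall>t. (\<integral>w. exp (\<i> * of_real (t * X 1 w)) \<partial>M) = exp (- \<Psi> t)) \<and>
     (\<forall>t. \<Psi> t = of_real (a * t\<^sup>2) + \<i> * of_real (b * t) +
        (\<integral>x. (1 - exp (\<i> * of_real (t * x)) + \<i> * of_real (t * x * indicator {x. \<bar>x\<bar> < 1} x)) \<partial>\<nu>))"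

text \<open>Slow variation at 0 (\<open>F = at_right 0\<close>) or at infinity (\<open>F = at_top\<close>) of a function
  \<open>(0,\<infinity>) \<rightarrow> [0,\<infinity>)\<close>. As \<open>x / 0 = 0\<close>, the limit 1 forces \<open>L\<close> to be
  eventually nonzero.\<close>

definition slowly_varying :: "real filter \<Rightarrow> (real \<Rightarrow> real) \<Rightarrow> bool" where
  "slowly_varying F L \<longleftrightarrow>
     (\<forall>x>0. 0 \<le> L x) \<and> (\<forall>c>0. ((\<lambda>x. L (c * x) / L x) \<longlongrightarrow> 1) F)"

text \<open>\<open>f \<sim> c g\<close> along \<open>F\<close>, that is \<open>f / g \<rightarrow> c\<close>, where \<open>c = 0\<close> is allowed. The nonvanishing of \<open>g\<close>
  is required explicitly because \<open>x / 0 = 0\<close> would otherwise matter when \<open>c = 0\<close>.\<close>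

definition asymp_mult :: "real filter \<Rightarrow> (real \<Rightarrow> real) \<Rightarrow> real \<Rightarrow> (real \<Rightarrow> real) \<Rightarrow> bool" where
  "asymp_mult F f c g \<longleftrightarrow>
     eventually (\<lambda>x. g x \<noteq> 0) F \<and> ((\<lambda>x. f x / g x) \<longlongrightarrow> c) F"

definition C_const :: "real \<Rightarrow> real" where
  "C_const \<gamma> = 1 / pi * (LBINT x:{0<..}. (1 - cos x) / x powr \<gamma>)"

end

theory Submission imports Defs "HOL-Real_Asymp.Real_Asymp"
begin

text \<open>
  Each half of the integral is treated separately. For one half, with density \<open>\<eta>\<close>, the
  substitution \<open>x = y / t\<close> turns the integral near 0 of \<open>g (t x) \<eta> x\<close> into \<open>\<eta> (1/t) / t\<close> times the
  integral of \<open>g y \<eta> (y/t) / \<eta> (1/t)\<close>, whose integrand tends to \<open>g y * y powr (- \<alpha> - 1)\<close>. A Potter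
  bound on \<open>\<eta>\<close> dominates it, since \<open>g\<close>, which is \<open>1 - cos y\<close> or \<open>y - sin y\<close>, is \<open>O(min y (y^2))\<close>.
  Away from 0 the integral grows at most linearly in \<open>t\<close>, as does the drift, and this is negligible
  because \<open>\<alpha> > 1\<close>. An integration by parts identifies the limit for \<open>y - sin y\<close>. The
  functions \<open>K\<^sub>p\<close>, \<open>K\<^sub>m\<close> need not be measurable, so the Potter bound is proved for the density itself.
\<close>

section \<open>Potter bounds\<close>

text \<open>The exceptional sets \<open>E x\<close> have small measure for large \<open>x\<close>; hence some \<open>v\<close> in \<open>[1,2]\<close> is exceptional
  neither for \<open>x\<close> nor, seen from \<open>x + u\<close>, for \<open>x + u\<close>, and \<open>f (x + v)\<close> is close to both values.\<close>

lemma slowly_varying_additive_local_bound: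
  fixes f :: "real \<Rightarrow> real"
  assumes [measurable]: "f \<in> borel_measurable borel"
    and lim: "\<And>u. ((\<lambda>x. f (x + u) - f x) \<longlongrightarrow> 0) at_top"
  shows "\<exists>X. \<forall>x\<ge>X. \<forall>u\<in>{0..1}. \<bar>f (x + u) - f x\<bar> \<le> 2"
proof -
  \<comment> \<open>The window \<open>{0..2}\<close> contains both \<open>v\<close> and
    \<open>v - u\<close> for every \<open>v\<close> in \<open>{1..2}\<close> and \<open>u\<close> in
    \<open>{0..1}\<close>, so one family of sets serves both base points \<open>x\<close> and
    \<open>x + u\<close>.\<close>
  define E where "E x = {v\<in>{0..2}. 1 \<le> \<bar>f (x + v) - f x\<bar>}" for x
  have [measurable]: "E x \<in> sets borel" for x
    unfolding E_def by measurable
  have fin: "emeasure lborel (E x) < \<infinity>" for x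
  proof -
    have "emeasure lborel (E x) \<le> emeasure lborel {0..2::real}"
      by (rule emeasure_mono) (auto simp: E_def)
    thus ?thesis by (auto simp: less_top[symmetric] top_unique)
  qed
  have "((\<lambda>x. \<integral>v. indicator (E x) v \<partial>lborel) \<longlongrightarrow> integral\<^sup>L lborel (\<lambda>v::real. 0::real)) at_top"
  proof (rule integral_dominated_convergence_at_top[where w = "indicator {0..2::real}"])
    show "\<forall>\<^sub>F x in at_top. AE v in lborel. norm (indicator (E x) v :: real) \<le> indicator {0..2} v"
      by (auto simp: E_def indicator_def)
    show "AE v in lborel. ((\<lambda>x. indicator (E x) v) \<longlongrightarrow> (0::real)) at_top"
    proof (rule AE_I2)
      fix v :: real
      have "eventually (\<lambda>x. \<bar>f (x + v) - f x\<bar> < 1) at_top"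
        using order_tendstoD(2)[OF tendsto_rabs[OF lim[of v]], of 1] by simp
      hence "eventually (\<lambda>x. indicator (E x) v = (0::real)) at_top"
        by eventually_elim (auto simp: E_def)
      thus "((\<lambda>x. indicator (E x) v) \<longlongrightarrow> (0::real)) at_top"
        by (simp add: tendsto_eventually)
    qed
  qed auto
  hence "((\<lambda>x. measure lborel (E x)) \<longlongrightarrow> 0) at_top"
    by simp
  \<comment> \<open>The threshold is \<open>1/2\<close> because two exceptional sets of smaller
    measure cannot cover \<open>{1..2}\<close>, which has length 1.\<close>
  hence "eventually (\<lambda>x. measure lborel (E x) < 1/2) at_top"
    by (rule order_tendstoD) simp
  then obtain X where X: "\<And>x. x \<ge> X \<Longrightarrow> measure lborel (E x) < 1/2"
    by (auto simp: eventually_at_top_linorder)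
  show ?thesis
  proof (intro exI allI impI ballI)
    fix x u :: real assume xu: "X \<le> x" "u \<in> {0..1}"
    \<comment> \<open>Translating \<open>E (x + u)\<close> by \<open>u\<close> expresses its
      condition through the common point \<open>x + v\<close> and preserves Lebesgue
      measure.\<close>
    define E' where "E' = {v. v - u \<in> E (x + u)}"
    have [measurable]: "E' \<in> sets borel"
      unfolding E'_def E_def by measurable
    have "emeasure lborel E' = emeasure (distr lborel borel ((+) u)) E'"
      by (simp add: lborel_distr_plus)
    also have "\<dots> = emeasure lborel ((+) u -` E')"
      by (subst emeasure_distr) auto
    also have "(+) u -` E' = E (x + u)"
      by (auto simp: E'_def)
    finally have E': "emeasure lborel E' = emeasure lborel (E (x + u))" .
    have "\<exists>v\<in>{1..2}. v \<notin> E x \<and> v \<notin> E'"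
    proof (rule ccontr)
      assume "\<not> ?thesis"
      hence "{1..2} \<subseteq> E x \<union> E'" by auto
      hence "emeasure lborel {1..2::real} \<le> emeasure lborel (E x \<union> E')"
        by (intro emeasure_mono) auto
      also have "\<dots> \<le> emeasure lborel (E x) + emeasure lborel E'"
        by (rule emeasure_subadditive) auto
      also have "\<dots> = ennreal (measure lborel (E x) + measure lborel (E (x + u)))"
        using fin[of x] fin[of "x + u"] E'
        by (simp add: emeasure_eq_ennreal_measure ennreal_plus less_top)
      also have "\<dots> < ennreal 1"
        using X[of x] X[of "x + u"] xu by (intro ennreal_lessI) auto
      finally show False by simp
    qed
    then obtain v where v: "v \<in> {1..2}" "v \<notin> E x" "v \<notin> E'" by blast
    have "\<bar>f (x + v) - f x\<bar> < 1" using v by (auto simp: E_def)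
    moreover have "\<bar>f (x + v) - f (x + u)\<bar> < 1"
      using v xu unfolding E'_def by (auto simp: E_def)
    ultimately show "\<bar>f (x + u) - f x\<bar> \<le> 2" by linarith
  qed
qed

text \<open>Going from \<open>t\<close> to \<open>s\<close> takes whole unit steps, each changing
  \<open>f\<close> by less than \<open>\<epsilon>\<close> once the argument is large, and one
  fractional step, which costs at most 2 by the local bound.\<close>

lemma slowly_varying_additive_linear_bound:
  fixes f :: "real \<Rightarrow> real"
  assumes "f \<in> borel_measurable borel"
    and lim: "\<And>u. ((\<lambda>x. f (x + u) - f x) \<longlongrightarrow> 0) at_top" and "\<epsilon> > 0"
  shows "\<exists>X. \<forall>s\<ge>X. \<forall>t\<ge>X. \<bar>f s - f t\<bar> \<le> 2 + \<epsilon> * \<bar>s - t\<bar>"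
proof -
  obtain X1 where X1: "\<And>x u. x \<ge> X1 \<Longrightarrow> u \<in> {0..1} \<Longrightarrow> \<bar>f (x + u) - f x\<bar> \<le> 2"
    using slowly_varying_additive_local_bound[OF assms(1,2)] by blast
  have "eventually (\<lambda>x. \<bar>f (x + 1) - f x\<bar> < \<epsilon>) at_top"
    using order_tendstoD(2)[OF tendsto_rabs[OF lim[of 1]], of \<epsilon>] \<open>\<epsilon> > 0\<close> by simp
  then obtain X2 where X2: "\<And>x. x \<ge> X2 \<Longrightarrow> \<bar>f (x + 1) - f x\<bar> < \<epsilon>"
    by (auto simp: eventually_at_top_linorder)
  define X where "X = max X1 X2"
  have step: "\<bar>f (x + of_nat n) - f x\<bar> \<le> \<epsilon> * of_nat n" if "x \<ge> X" for x n
  proof (induction n)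
    case (Suc n)
    have "\<bar>f (x + of_nat n + 1) - f (x + of_nat n)\<bar> < \<epsilon>"
      using that by (intro X2) (auto simp: X_def)
    moreover have "x + real (Suc n) = x + real n + 1" by simp
    moreover have "\<epsilon> * real (Suc n) = \<epsilon> * real n + \<epsilon>" by (simp add: algebra_simps)
    ultimately show ?case using Suc.IH by (smt (verit, del_insts))
  qed simp
  have up: "\<bar>f s - f t\<bar> \<le> 2 + \<epsilon> * \<bar>s - t\<bar>" if "t \<ge> X" "s \<ge> t" for s t
  proof -
    define n where "n = nat \<lfloor>s - t\<rfloor>"
    have n: "real n \<le> s - t" "s - t \<le> real n + 1"
      using that unfolding n_def by linarith+
    have "\<bar>f (t + n) - f t\<bar> \<le> \<epsilon> * n" by (rule step) fact
    moreover have "\<bar>f (t + n + (s - t - n)) - f (t + n)\<bar> \<le> 2"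
      using n that by (intro X1) (auto simp: X_def)
    moreover have "\<epsilon> * n \<le> \<epsilon> * \<bar>s - t\<bar>"
      using n that \<open>\<epsilon> > 0\<close> by (intro mult_left_mono) auto
    moreover have "t + n + (s - t - n) = s" by simp
    ultimately show ?thesis by (smt (verit))
  qed
  have "\<bar>f s - f t\<bar> \<le> 2 + \<epsilon> * \<bar>s - t\<bar>" if "t \<ge> X" "s \<ge> X" for s t
    using up[of t s] up[of s t] that by (cases "s \<ge> t") (auto simp: abs_minus_commute)
  thus ?thesis by blast
qed

text \<open>In the coordinate \<open>x = exp (- s)\<close>, with the power \<open>\<rho>\<close>
  divided out and logarithms taken, regular variation becomes the additive condition of the
  preceding lemma, and the linear bound is exponentiated. Its constant 2 becomes
  \<open>exp 2\<close>. The sum of the two powers of \<open>c\<close> majorises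
  \<open>exp (\<epsilon> * \<bar>ln c\<bar>)\<close> for small and large \<open>c\<close>
  alike.\<close>

lemma potter_bound:
  fixes \<eta> :: "real \<Rightarrow> real"
  assumes [measurable]: "\<eta> \<in> borel_measurable borel" and nn: "\<And>x. 0 \<le> \<eta> x"
    and lim: "\<And>c. c > 0 \<Longrightarrow> ((\<lambda>x. \<eta> (c * x) / \<eta> x) \<longlongrightarrow> c powr \<rho>) (at_right 0)"
    and "\<epsilon> > 0"
  obtains \<delta> where "\<delta> > 0" "\<And>x. 0 < x \<Longrightarrow> x \<le> \<delta> \<Longrightarrow> \<eta> x > 0"
    "\<And>c x. 0 < c \<Longrightarrow> 0 < x \<Longrightarrow> x \<le> \<delta> \<Longrightarrow> c * x \<le> \<delta> \<Longrightarrow>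
       \<eta> (c * x) \<le> exp 2 * c powr \<rho> * (c powr \<epsilon> + c powr (- \<epsilon>)) * \<eta> x"
proof -
  have exp_lim: "filterlim (\<lambda>s::real. exp (- s)) (at_right 0) at_top"
    by real_asymp
  have "eventually (\<lambda>x. \<eta> x > 0) (at_right 0)"
  proof -
    \<comment> \<open>The case \<open>c = 1\<close> of the hypothesis has limit 1. As
      \<open>x / 0 = 0\<close>, this already forces \<open>\<eta>\<close> to be nonzero near
      0.\<close>
    have "eventually (\<lambda>x. \<eta> (1 * x) / \<eta> x > 0) (at_right 0)"
      by (rule order_tendstoD(1)[OF lim]) auto
    thus ?thesis by eventually_elim (use nn in \<open>auto simp: zero_less_divide_iff order.strict_iff_order\<close>)
  qed
  then obtain \<delta>0 where \<delta>0: "\<delta>0 > 0" "\<And>x. 0 < x \<Longrightarrow> x < \<delta>0 \<Longrightarrow> \<eta> x > 0"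
    by (auto simp: eventually_at_right_field)
  \<comment> \<open>This is the logarithm of \<open>\<eta> x * x powr (- \<rho>)\<close> at
    \<open>x = exp (- s)\<close>, wherever \<open>\<eta> x\<close> is positive.\<close>
  define f where "f s = ln (\<eta> (exp (- s))) + \<rho> * s" for s
  have [measurable]: "f \<in> borel_measurable borel" unfolding f_def by measurable
  have f: "((\<lambda>s. f (s + u) - f s) \<longlongrightarrow> 0) at_top" for u
  proof -
    have "((\<lambda>s. \<eta> (exp (- u) * exp (- s)) / \<eta> (exp (- s))) \<longlongrightarrow> exp (- u) powr \<rho>) at_top"
      by (rule filterlim_compose[OF lim exp_lim]) auto
    hence "((\<lambda>s. ln (\<eta> (exp (- u) * exp (- s)) / \<eta> (exp (- s))) + \<rho> * u) \<longlongrightarrow> ln (exp (- u) powr \<rho>) + \<rho> * u) at_top"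
      by (intro tendsto_intros) auto
    moreover have "ln (exp (- u) powr \<rho>) + \<rho> * u = 0" by (simp add: ln_powr)
    moreover have "eventually (\<lambda>s. s > max (- ln \<delta>0) (- ln \<delta>0 - u)) at_top"
      by (rule eventually_gt_at_top)
    hence "eventually (\<lambda>s. ln (\<eta> (exp (- u) * exp (- s)) / \<eta> (exp (- s))) + \<rho> * u = f (s + u) - f s) at_top"
    proof eventually_elim
      case (elim s)
      have "exp (- s) < exp (ln \<delta>0)" "exp (- u - s) < exp (ln \<delta>0)"
        using elim by auto
      hence "\<eta> (exp (- s)) > 0" "\<eta> (exp (- u - s)) > 0" using \<delta>0 by simp_all
      moreover have "exp (- u) * exp (- s) = exp (- u - s)" by (simp add: mult_exp_exp)
      moreover have "- (s + u) = - u - s" by simp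
      ultimately show ?case unfolding f_def by (simp only: ln_div) (simp add: distrib_left)
    qed
    ultimately show ?thesis by (simp add: filterlim_cong)
  qed
  obtain X where X: "\<And>s t. s \<ge> X \<Longrightarrow> t \<ge> X \<Longrightarrow> \<bar>f s - f t\<bar> \<le> 2 + \<epsilon> * \<bar>s - t\<bar>"
    using slowly_varying_additive_linear_bound[OF _ f \<open>\<epsilon> > 0\<close>] by auto
  \<comment> \<open>Halving \<open>\<delta>0\<close> turns the strict bound on the positivity range
    into \<open>x \<le> \<delta>\<close>; the other entry ensures \<open>- ln x \<ge> X\<close>, the
    range of the linear bound.\<close>
  define \<delta> where "\<delta> = min (\<delta>0 / 2) (exp (- X))"
  have "\<delta> > 0" using \<delta>0 by (simp add: \<delta>_def)
  have pos: "\<eta> x > 0" if "0 < x" "x \<le> \<delta>" for x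
    using \<delta>0 that by (auto simp: \<delta>_def)
  have "\<eta> (c * x) \<le> exp 2 * c powr \<rho> * (c powr \<epsilon> + c powr (- \<epsilon>)) * \<eta> x"
    if "0 < c" "0 < x" "x \<le> \<delta>" "c * x \<le> \<delta>" for c x
  proof -
    have le: "- ln y \<ge> X" if "0 < y" "y \<le> \<delta>" for y
    proof -
      have "ln y \<le> ln (exp (- X))" using that by (intro ln_mono) (auto simp: \<delta>_def)
      thus ?thesis by simp
    qed
    have "\<bar>f (- ln (c * x)) - f (- ln x)\<bar> \<le> 2 + \<epsilon> * \<bar>ln c\<bar>"
      using X[OF le le, of "c * x" x] that by (simp add: ln_mult)
    moreover have "f (- ln (c * x)) - f (- ln x) = ln (\<eta> (c * x)) - ln (\<eta> x) - \<rho> * ln c"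
      using that by (simp add: f_def ln_mult exp_add algebra_simps)
    ultimately have "ln (\<eta> (c * x)) \<le> 2 + \<rho> * ln c + \<epsilon> * \<bar>ln c\<bar> + ln (\<eta> x)" by linarith
    hence "exp (ln (\<eta> (c * x))) \<le> exp (2 + \<rho> * ln c + \<epsilon> * \<bar>ln c\<bar> + ln (\<eta> x))" by simp
    hence "\<eta> (c * x) \<le> exp 2 * c powr \<rho> * exp (\<epsilon> * \<bar>ln c\<bar>) * \<eta> x"
      using pos[of x] pos[of "c * x"] that by (simp add: exp_add powr_def)
    also have "\<dots> \<le> exp 2 * c powr \<rho> * (c powr \<epsilon> + c powr (- \<epsilon>)) * \<eta> x"
      using pos[of x] that
      by (intro mult_right_mono mult_left_mono) (auto simp: powr_def abs_if)
    finally show ?thesis .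
  qed
  thus ?thesis using that[OF \<open>\<delta> > 0\<close> pos] by blast
qed

section \<open>Asymptotics of one-sided integrals\<close>

text \<open>Source of the integrable majorants below: one power is integrable at 0, the other at
  infinity. The two pieces overlap only at 1.\<close>

lemma integrable_powr_split:
  fixes p q :: real
  assumes "p > - 1" "q < - 1"
  shows "integrable lborel (\<lambda>y. indicator {0<..1} y * y powr p + indicator {1..} y * y powr q)"
proof (rule Bochner_Integration.integrable_add)
  have "(\<lambda>y. y powr p) absolutely_integrable_on {0<..1}"
    using assms by (intro nonnegative_absolutely_integrable_1 integrable_on_powr_from_0') auto
  thus "integrable lborel (\<lambda>y. indicator {0<..1} y * y powr p)"
    by (simp add: set_integrable_def integrable_completion)
  have "(\<lambda>y. y powr q) absolutely_integrable_on {1..}"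
    using has_integral_powr_to_inf[of q 1] assms
    by (intro nonnegative_absolutely_integrable_1) (auto simp: integrable_on_def)
  thus "integrable lborel (\<lambda>y. indicator {1..} y * y powr q)"
    by (simp add: set_integrable_def integrable_completion)
qed

text \<open>Here \<open>u\<close> stands for a kernel value and the other factor is the Potter
  bound. Up to 1 the dominant terms are \<open>y\<^sup>2\<close> and
  \<open>y powr (- \<epsilon>)\<close>, beyond 1 they are \<open>y\<close> and
  \<open>y powr \<epsilon>\<close>. The factor 4 combines the 2 of the kernel bound with the 2 from
  replacing a sum of two powers by twice the larger.\<close>

lemma potter_kernel_bound:
  fixes y u \<alpha> \<epsilon> :: real
  assumes "y > 0" "\<epsilon> > 0" "\<bar>u\<bar> \<le> 2 * min y (y\<^sup>2)"
  shows "\<bar>u\<bar> * (exp 2 * y powr (- \<alpha> - 1) * (y powr \<epsilon> + y powr (- \<epsilon>)))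
    \<le> 4 * exp 2 * (indicator {0<..1} y * y powr (1 - \<alpha> - \<epsilon>) + indicator {1..} y * y powr (- \<alpha> + \<epsilon>))"
proof (cases "y \<le> 1")
  case True
  have "y powr \<epsilon> \<le> y powr (- \<epsilon>)" using assms True by (intro powr_mono') auto
  hence "\<bar>u\<bar> * (exp 2 * y powr (- \<alpha> - 1) * (y powr \<epsilon> + y powr (- \<epsilon>)))
      \<le> (2 * y powr 2) * (exp 2 * y powr (- \<alpha> - 1) * (2 * y powr (- \<epsilon>)))"
    using assms by (intro mult_mono) (auto simp: powr_numeral)
  also have "\<dots> = 4 * exp 2 * (y powr 2 * y powr (- \<alpha> - 1) * y powr (- \<epsilon>))" by simp
  also have "y powr 2 * y powr (- \<alpha> - 1) * y powr (- \<epsilon>) = y powr (1 - \<alpha> - \<epsilon>)"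
    by (simp flip: powr_add)
  finally show ?thesis
    by (rule order_trans) (use True assms(1) in \<open>auto simp: indicator_def\<close>)
next
  case False
  have "y powr (- \<epsilon>) \<le> y powr \<epsilon>" using assms False by (intro powr_mono) auto
  hence "\<bar>u\<bar> * (exp 2 * y powr (- \<alpha> - 1) * (y powr \<epsilon> + y powr (- \<epsilon>)))
      \<le> (2 * y powr 1) * (exp 2 * y powr (- \<alpha> - 1) * (2 * y powr \<epsilon>))"
    using assms by (intro mult_mono) auto
  also have "\<dots> = 4 * exp 2 * (y powr 1 * y powr (- \<alpha> - 1) * y powr \<epsilon>)" by simp
  also have "y powr 1 * y powr (- \<alpha> - 1) * y powr \<epsilon> = y powr (- \<alpha> + \<epsilon>)"
    by (simp only: powr_add[symmetric]) simp
  finally show ?thesis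
    using assms False by (auto simp: indicator_def)
qed

lemma kernel_integral_near_0:
  fixes \<eta> g :: "real \<Rightarrow> real" and \<alpha> :: real
  assumes [measurable]: "\<eta> \<in> borel_measurable borel" "g \<in> borel_measurable borel"
    and nn: "\<And>x. 0 \<le> \<eta> x"
    and \<alpha>: "1 < \<alpha>" "\<alpha> < 2"
    and lim: "\<And>c. c > 0 \<Longrightarrow> ((\<lambda>x. \<eta> (c * x) / \<eta> x) \<longlongrightarrow> c powr (- \<alpha> - 1)) (at_right 0)"
    and g: "\<And>y. y > 0 \<Longrightarrow> \<bar>g y\<bar> \<le> 2 * min y (y\<^sup>2)"
  obtains \<delta> where "0 < \<delta>" "\<delta> < 1"
    "((\<lambda>t. (\<integral>x. indicator {0<..<\<delta>} x * (g (t * x) * \<eta> x) \<partial>lborel) / (\<eta> (1 / t) / t)) \<longlongrightarrow>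
       (\<integral>y. indicator {0<..} y * (g y * y powr (- \<alpha> - 1)) \<partial>lborel)) at_top"
proof -
  \<comment> \<open>Integrability of the majorant at infinity requires
    \<open>\<epsilon> < \<alpha> - 1\<close>, and at 0 it requires
    \<open>\<epsilon> < 2 - \<alpha>\<close>; half of the smaller gap meets both.\<close>
  define \<epsilon> where "\<epsilon> = min ((\<alpha> - 1) / 2) ((2 - \<alpha>) / 2)"
  have \<epsilon>: "\<epsilon> > 0" "1 - \<alpha> - \<epsilon> > - 1" "- \<alpha> + \<epsilon> < - 1"
    using \<alpha> by (simp_all add: \<epsilon>_def min_def field_simps)
  obtain \<delta>0 where \<delta>0: "\<delta>0 > 0" "\<And>x. 0 < x \<Longrightarrow> x \<le> \<delta>0 \<Longrightarrow> \<eta> x > 0"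
    "\<And>c x. 0 < c \<Longrightarrow> 0 < x \<Longrightarrow> x \<le> \<delta>0 \<Longrightarrow> c * x \<le> \<delta>0 \<Longrightarrow>
       \<eta> (c * x) \<le> exp 2 * c powr (- \<alpha> - 1) * (c powr \<epsilon> + c powr (- \<epsilon>)) * \<eta> x"
    using potter_bound[OF assms(1) nn lim \<epsilon>(1)] by blast
  \<comment> \<open>The cap \<open>1/2\<close> keeps the interval inside the unit interval, where
    the truncated kernel still depends on \<open>t * x\<close> alone.\<close>
  define \<delta> where "\<delta> = min \<delta>0 (1/2)"
  have \<delta>: "0 < \<delta>" "\<delta> < 1" "\<delta> \<le> \<delta>0" using \<delta>0 by (auto simp: \<delta>_def)
  \<comment> \<open>The integrand after substituting \<open>x = y / t\<close> and dividing by
    \<open>\<eta> (1 / t) / t\<close>; the Jacobian \<open>1 / t\<close> cancels against the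
    normaliser.\<close>
  define s where "s t y = indicator {0<..<\<delta> * t} y * (g y * (\<eta> (y / t) / \<eta> (1 / t)))" for t y
  define D where "D y = 4 * exp 2 * (indicator {0<..1} y * y powr (1 - \<alpha> - \<epsilon>) +
    indicator {1..} y * y powr (- \<alpha> + \<epsilon>))" for y
  have "((\<lambda>t. integral\<^sup>L lborel (s t)) \<longlongrightarrow>
     (\<integral>y. indicator {0<..} y * (g y * y powr (- \<alpha> - 1)) \<partial>lborel)) at_top"
  proof (rule integral_dominated_convergence_at_top)
    show "integrable lborel D"
      unfolding D_def by (intro integrable_mult_right integrable_powr_split \<epsilon>)
    show "AE y in lborel. ((\<lambda>t. s t y) \<longlongrightarrow> indicator {0<..} y * (g y * y powr (- \<alpha> - 1))) at_top"
    proof (rule AE_I2)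
      fix y :: real
      show "((\<lambda>t. s t y) \<longlongrightarrow> indicator {0<..} y * (g y * y powr (- \<alpha> - 1))) at_top"
      proof (cases "y > 0")
        case True
        have "filterlim (\<lambda>t::real. 1 / t) (at_right 0) at_top" by real_asymp
        from filterlim_compose[OF lim[OF True] this]
        have "((\<lambda>t. g y * (\<eta> (y / t) / \<eta> (1 / t))) \<longlongrightarrow> g y * y powr (- \<alpha> - 1)) at_top"
          by (intro tendsto_intros) auto
        moreover have "eventually (\<lambda>t. g y * (\<eta> (y / t) / \<eta> (1 / t)) = s t y) at_top"
          using eventually_gt_at_top[of "y / \<delta>"]
          by eventually_elim (use \<delta> True in \<open>auto simp: s_def indicator_def field_simps\<close>)
        ultimately show ?thesis using True by (simp add: filterlim_cong)
      qed (auto simp: s_def)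
    qed
    \<comment> \<open>The Potter bound is used at base point \<open>1 / t\<close> with multiplier
      \<open>y\<close>. The thresholds \<open>t > 1 / \<delta>\<close> and
      \<open>y < \<delta> * t\<close> bring \<open>1 / t\<close> and \<open>y / t\<close> into its
      range.\<close>
    show "\<forall>\<^sub>F t in at_top. AE y in lborel. norm (s t y) \<le> D y"
      using eventually_gt_at_top[of "1 / \<delta>"]
    proof eventually_elim
      case (elim t)
      have t: "t > 0" "1 / t \<le> \<delta>0"
      proof -
        show "t > 0" using elim \<delta> by (meson less_trans zero_less_divide_1_iff)
        thus "1 / t \<le> \<delta>0" using elim \<delta> by (auto simp: field_simps intro: order_trans[of _ "\<delta> * t"] less_imp_le)
      qed
      show ?case
      proof (rule AE_I2)
        fix y
        show "norm (s t y) \<le> D y"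
        proof (cases "y \<in> {0<..<\<delta> * t}")
          case True
          hence y: "y > 0" "y / t \<le> \<delta>0" using t \<delta> by (auto simp: field_simps intro: order_trans[of _ "\<delta> * t"] less_imp_le)
          have "norm (s t y) = \<bar>g y\<bar> * (\<eta> (y / t) / \<eta> (1 / t))"
            using True nn by (simp add: s_def abs_mult)
          also have "\<eta> (y / t) / \<eta> (1 / t) \<le> exp 2 * y powr (- \<alpha> - 1) * (y powr \<epsilon> + y powr (- \<epsilon>))"
            using \<delta>0(3)[of y "1 / t"] \<delta>0(2)[of "1 / t"] y t by (simp add: field_simps)
          hence "\<bar>g y\<bar> * (\<eta> (y / t) / \<eta> (1 / t)) \<le> \<bar>g y\<bar> * \<dots>"
            by (intro mult_left_mono) auto
          also have "\<dots> \<le> D y"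
            unfolding D_def by (intro potter_kernel_bound y \<epsilon> g)
          finally show ?thesis .
        qed (auto simp: s_def D_def)
      qed
    qed
  qed (auto simp: s_def[abs_def])
  moreover have "eventually (\<lambda>t. integral\<^sup>L lborel (s t) =
      (\<integral>x. indicator {0<..<\<delta>} x * (g (t * x) * \<eta> x) \<partial>lborel) / (\<eta> (1 / t) / t)) at_top"
    using eventually_gt_at_top[of 0]
  proof eventually_elim
    case (elim t)
    have "integral\<^sup>L lborel (s t) = t * (\<integral>x. s t (t * x) \<partial>lborel)"
      using lborel_integral_real_affine[of t "s t" 0] elim by simp
    also have "(\<lambda>x. s t (t * x)) = (\<lambda>x. (indicator {0<..<\<delta>} x * (g (t * x) * \<eta> x)) / \<eta> (1 / t))"
      using elim by (auto simp: s_def fun_eq_iff indicator_def zero_less_mult_iff mult.commute)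
    finally show ?case by simp
  qed
  ultimately show ?thesis using \<delta> by (intro that[of \<delta>]) (simp_all add: filterlim_cong)
qed

text \<open>Comparing \<open>\<eta> (1 / t)\<close> with the fixed value
  \<open>\<eta> \<delta>\<close> by the Potter bound shows that \<open>\<eta> (1 / t) / t\<close>
  grows at least like \<open>t powr (\<alpha> - \<epsilon>)\<close>, with exponent above 1. The
  numerator \<open>1 + t\<close> is the growth of the tail integral and majorises that of the
  drift.\<close>

lemma regularly_varying_dominates_linear:
  fixes \<eta> :: "real \<Rightarrow> real" and \<alpha> :: real
  assumes "\<eta> \<in> borel_measurable borel"
    and nn: "\<And>x. 0 \<le> \<eta> x" and "1 < \<alpha>"
    and lim: "\<And>c. c > 0 \<Longrightarrow> ((\<lambda>x. \<eta> (c * x) / \<eta> x) \<longlongrightarrow> c powr (- \<alpha> - 1)) (at_right 0)"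
  shows "((\<lambda>t. (1 + t) / (\<eta> (1 / t) / t)) \<longlongrightarrow> 0) at_top"
proof -
  define \<epsilon> where "\<epsilon> = (\<alpha> - 1) / 2"
  have \<epsilon>: "\<epsilon> > 0" "1 - \<alpha> + \<epsilon> < 0" using \<open>1 < \<alpha>\<close> by (simp_all add: \<epsilon>_def min_def field_simps)
  obtain \<delta> where \<delta>: "\<delta> > 0" "\<And>x. 0 < x \<Longrightarrow> x \<le> \<delta> \<Longrightarrow> \<eta> x > 0"
    "\<And>c x. 0 < c \<Longrightarrow> 0 < x \<Longrightarrow> x \<le> \<delta> \<Longrightarrow> c * x \<le> \<delta> \<Longrightarrow>
       \<eta> (c * x) \<le> exp 2 * c powr (- \<alpha> - 1) * (c powr \<epsilon> + c powr (- \<epsilon>)) * \<eta> x"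
    using potter_bound[OF assms(1) nn lim \<epsilon>(1)] by blast
  \<comment> \<open>Obtained from the Potter bound with multiplier \<open>\<delta> * t\<close> at
    base point \<open>1 / t\<close>, whose product is exactly \<open>\<delta>\<close>; solved for
    \<open>1 / \<eta> (1 / t)\<close>.\<close>
  define B where "B t = exp 2 * (\<delta> * t) powr (- \<alpha> - 1) * ((\<delta> * t) powr \<epsilon> + (\<delta> * t) powr (- \<epsilon>)) / \<eta> \<delta>" for t
  have B: "((\<lambda>t. (1 + t) * t * B t) \<longlongrightarrow> 0) at_top"
    using \<epsilon> \<delta>(1) \<delta>(2)[of \<delta>] \<open>1 < \<alpha>\<close> unfolding B_def by real_asymp
  show ?thesis
  proof (rule tendsto_sandwich[OF _ _ tendsto_const B])
    show "\<forall>\<^sub>F t in at_top. 0 \<le> (1 + t) / (\<eta> (1 / t) / t)"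
      using eventually_gt_at_top[of 0] by eventually_elim (use nn in auto)
    show "\<forall>\<^sub>F t in at_top. (1 + t) / (\<eta> (1 / t) / t) \<le> (1 + t) * t * B t"
      using eventually_gt_at_top[of "1 / \<delta>"]
    proof eventually_elim
      case (elim t)
      have t: "t > 0" using elim \<delta>(1) by (meson less_trans zero_less_divide_1_iff)
      hence t': "1 / t \<le> \<delta>" using elim \<delta>(1) by (simp add: field_simps)
      have "1 / \<eta> (1 / t) \<le> B t"
        using \<delta>(3)[of "\<delta> * t" "1 / t"] \<delta>(2)[of \<delta>] \<delta>(2)[of "1 / t"] t t' \<delta>(1)
        unfolding B_def by (simp add: field_simps)
      hence "(1 + t) * t * (1 / \<eta> (1 / t)) \<le> (1 + t) * t * B t"
        using t by (intro mult_left_mono) auto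
      thus ?case by simp
    qed
  qed
qed

text \<open>The quotient \<open>q\<close> of \<open>\<eta>\<close> by its model tends to 1 along
  \<open>x\<close> and along \<open>c * x\<close>, so the ratio of \<open>\<eta>\<close> values
  inherits the limit of the model.\<close>

lemma regularly_varying_of_asymp:
  fixes \<eta> K :: "real \<Rightarrow> real"
  assumes K: "slowly_varying (at_right 0) K"
    and \<eta>: "asymp_mult (at_right 0) \<eta> 1 (\<lambda>x. x powr \<rho> * K x)" and "c > 0"
  shows "((\<lambda>x. \<eta> (c * x) / \<eta> x) \<longlongrightarrow> c powr \<rho>) (at_right 0)"
proof -
  define q where "q x = \<eta> x / (x powr \<rho> * K x)" for x
  have q: "(q \<longlongrightarrow> 1) (at_right 0)" and nz: "eventually (\<lambda>x. x powr \<rho> * K x \<noteq> 0) (at_right 0)"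
    using \<eta> by (auto simp: asymp_mult_def q_def[abs_def])
  have c: "filterlim ((*) c) (at_right 0) (at_right 0)"
    using \<open>c > 0\<close> by real_asymp
  have Kc: "((\<lambda>x. K (c * x) / K x) \<longlongrightarrow> 1) (at_right 0)"
    using K \<open>c > 0\<close> by (auto simp: slowly_varying_def)
  have "((\<lambda>x. q (c * x) / q x * c powr \<rho> * (K (c * x) / K x)) \<longlongrightarrow> 1 / 1 * c powr \<rho> * 1) (at_right 0)"
    by (intro tendsto_intros q Kc filterlim_compose[OF q c]) auto
  moreover have "eventually (\<lambda>x. q (c * x) / q x * c powr \<rho> * (K (c * x) / K x) = \<eta> (c * x) / \<eta> x) (at_right 0)"
    using nz eventually_compose_filterlim[OF nz c] eventually_at_right_less[of 0]
  proof eventually_elim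
    case (elim x)
    have "(c * x) powr \<rho> = c powr \<rho> * x powr \<rho>"
      using elim \<open>c > 0\<close> by (simp add: powr_mult)
    thus ?case using elim \<open>c > 0\<close> by (simp add: q_def)
  qed
  ultimately show ?thesis by (simp add: filterlim_cong)
qed

text \<open>Exchanges the normaliser \<open>\<eta> (1 / t) / t\<close>, natural for the scaling
  argument, for \<open>t powr \<alpha> * K (1 / t)\<close>, in which the result is stated.\<close>

lemma asymp_at_inverse:
  fixes \<eta> K :: "real \<Rightarrow> real"
  assumes \<eta>: "asymp_mult (at_right 0) \<eta> 1 (\<lambda>x. x powr (- \<alpha> - 1) * K x)"
  shows "((\<lambda>t. (\<eta> (1 / t) / t) / (t powr \<alpha> * K (1 / t))) \<longlongrightarrow> 1) at_top"
    "eventually (\<lambda>t. K (1 / t) \<noteq> 0) at_top"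
proof -
  have inv: "filterlim (\<lambda>t::real. 1 / t) (at_right 0) at_top" by real_asymp
  have "((\<lambda>t. \<eta> (1 / t) / ((1 / t) powr (- \<alpha> - 1) * K (1 / t))) \<longlongrightarrow> 1) at_top"
    using \<eta> filterlim_compose[OF _ inv] by (auto simp: asymp_mult_def)
  moreover have "eventually (\<lambda>t. \<eta> (1 / t) / ((1 / t) powr (- \<alpha> - 1) * K (1 / t)) =
      (\<eta> (1 / t) / t) / (t powr \<alpha> * K (1 / t))) at_top"
    using eventually_gt_at_top[of 0]
  proof eventually_elim
    case (elim t)
    have "(1 / t) powr (- \<alpha> - 1) = t powr \<alpha> * t"
      using elim by (simp add: powr_divide powr_diff powr_minus)
    thus ?case by (simp add: mult_ac)
  qed
  ultimately show "((\<lambda>t. (\<eta> (1 / t) / t) / (t powr \<alpha> * K (1 / t))) \<longlongrightarrow> 1) at_top"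
    by (simp add: filterlim_cong)
  have "eventually (\<lambda>x. K x \<noteq> 0) (at_right 0)"
    using \<eta> by (auto simp: asymp_mult_def elim: eventually_mono)
  thus "eventually (\<lambda>t. K (1 / t) \<noteq> 0) at_top"
    by (rule eventually_compose_filterlim[OF _ inv])
qed

text \<open>\<open>G\<close> is the actual kernel and \<open>g\<close> its scaling form. Truncation
  at 1 can destroy the scaling for larger \<open>x\<close>, so the scaling limit is used only on a
  short interval at 0 and the rest is merely bounded.\<close>

lemma one_sided_integral_asymp:
  fixes \<eta> K g :: "real \<Rightarrow> real" and G :: "real \<Rightarrow> real \<Rightarrow> real"
  assumes [measurable]: "\<eta> \<in> borel_measurable borel" "g \<in> borel_measurable borel"
      "\<And>t. G t \<in> borel_measurable borel"
    and nn: "\<And>x. 0 \<le> \<eta> x"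
    and \<alpha>: "1 < \<alpha>" "\<alpha> < 2"
    and K: "slowly_varying (at_right 0) K"
    and \<eta>: "asymp_mult (at_right 0) \<eta> 1 (\<lambda>x. x powr (- \<alpha> - 1) * K x)"
    and levy: "integrable lborel (\<lambda>x. indicator {0<..} x * (min (x\<^sup>2) 1 * \<eta> x))"
    and g: "\<And>y. y > 0 \<Longrightarrow> \<bar>g y\<bar> \<le> 2 * min y (y\<^sup>2)"
    and Gg: "\<And>t x. 0 < x \<Longrightarrow> x < 1 \<Longrightarrow> G t x = g (t * x)"
    and G: "\<And>t x. 0 < t \<Longrightarrow> 0 < x \<Longrightarrow> \<bar>G t x\<bar> \<le> 2 * (1 + t)"
  shows "((\<lambda>t. (\<integral>x. indicator {0<..} x * (G t x * \<eta> x) \<partial>lborel) / (t powr \<alpha> * K (1 / t))) \<longlongrightarrow>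
       (\<integral>y. indicator {0<..} y * (g y * y powr (- \<alpha> - 1)) \<partial>lborel)) at_top"
    (is "(_ \<longlongrightarrow> ?I) _")
proof -
  note lim = regularly_varying_of_asymp[OF K \<eta>]
  obtain \<delta> where \<delta>: "0 < \<delta>" "\<delta> < 1"
    "((\<lambda>t. (\<integral>x. indicator {0<..<\<delta>} x * (g (t * x) * \<eta> x) \<partial>lborel) / (\<eta> (1 / t) / t)) \<longlongrightarrow> ?I) at_top"
    using kernel_integral_near_0[OF assms(1,2) nn \<alpha> lim g] by blast
  define N where "N t = (\<integral>x. indicator {0<..<\<delta>} x * (g (t * x) * \<eta> x) \<partial>lborel)" for t
  define R where "R t = (\<integral>x. indicator {\<delta>..} x * (G t x * \<eta> x) \<partial>lborel)" for t
  \<comment> \<open>Since \<open>\<delta> < 1\<close>, the weight of the Levy condition is at least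
    \<open>\<delta>\<^sup>2\<close> on this range, so the density itself is integrable
    there.\<close>
  have tail: "integrable lborel (\<lambda>x. indicator {\<delta>..} x * \<eta> x)"
  proof (rule Bochner_Integration.integrable_bound)
    show "integrable lborel (\<lambda>x. 1 / \<delta>\<^sup>2 * (indicator {0<..} x * (min (x\<^sup>2) 1 * \<eta> x)))"
      by (intro integrable_mult_right levy)
    show "AE x in lborel. norm (indicator {\<delta>..} x * \<eta> x) \<le>
        norm (1 / \<delta>\<^sup>2 * (indicator {0<..} x * (min (x\<^sup>2) 1 * \<eta> x)))"
    proof (rule AE_I2)
      fix x
      have "\<eta> x \<le> 1 / \<delta>\<^sup>2 * (min (x\<^sup>2) 1 * \<eta> x)" if "x \<ge> \<delta>"
      proof -
        have "\<delta>\<^sup>2 \<le> min (x\<^sup>2) 1"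
          using \<delta> that by (auto simp: power_le_one intro: power_mono)
        hence "\<delta>\<^sup>2 * \<eta> x \<le> min (x\<^sup>2) 1 * \<eta> x" using nn by (intro mult_right_mono) auto
        thus ?thesis using \<delta>(1) by (simp add: field_simps)
      qed
      thus "norm (indicator {\<delta>..} x * \<eta> x) \<le> norm (1 / \<delta>\<^sup>2 * (indicator {0<..} x * (min (x\<^sup>2) 1 * \<eta> x)))"
        using \<delta>(1) nn[of x] by (auto simp: indicator_def)
    qed
  qed auto
  have bnd: "norm (indicator {\<delta>..} x * (G t x * \<eta> x)) \<le> 2 * (1 + t) * (indicator {\<delta>..} x * \<eta> x)"
    if "t > 0" for t x
  proof (cases "x \<ge> \<delta>")
    case True
    have "\<bar>G t x\<bar> * \<eta> x \<le> 2 * (1 + t) * \<eta> x"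
      using G[OF that, of x] True \<delta>(1) nn by (intro mult_right_mono) auto
    thus ?thesis using True nn[of x] by (simp add: abs_mult)
  qed auto
  \<comment> \<open>Additivity of the Bochner integral requires each piece to be integrable. The
    bound here is for a fixed \<open>t\<close>, so its growth in \<open>t\<close> does no
    harm.\<close>
  have near: "integrable lborel (\<lambda>x. indicator {0<..<\<delta>} x * (g (t * x) * \<eta> x))" if "t > 0" for t
  proof (rule Bochner_Integration.integrable_bound)
    show "integrable lborel (\<lambda>x. (2 * t\<^sup>2) * (indicator {0<..} x * (min (x\<^sup>2) 1 * \<eta> x)))"
      by (intro integrable_mult_right levy)
    show "AE x in lborel. norm (indicator {0<..<\<delta>} x * (g (t * x) * \<eta> x)) \<le>
        norm ((2 * t\<^sup>2) * (indicator {0<..} x * (min (x\<^sup>2) 1 * \<eta> x)))"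
    proof (rule AE_I2)
      fix x
      show "norm (indicator {0<..<\<delta>} x * (g (t * x) * \<eta> x)) \<le>
        norm ((2 * t\<^sup>2) * (indicator {0<..} x * (min (x\<^sup>2) 1 * \<eta> x)))"
      proof (cases "x \<in> {0<..<\<delta>}")
        case True
        have "x\<^sup>2 \<le> 1" using True \<delta> by (auto simp: power_le_one)
        hence "min (x\<^sup>2) 1 = x\<^sup>2" by simp
        moreover have "\<bar>g (t * x)\<bar> * \<eta> x \<le> (2 * (t * x)\<^sup>2) * \<eta> x"
          using g[of "t * x"] True that nn by (intro mult_right_mono) auto
        ultimately show ?thesis
          using True nn[of x] by (simp add: abs_mult power_mult_distrib mult_ac)
      qed auto
    qed
  qed auto
  have far: "integrable lborel (\<lambda>x. indicator {\<delta>..} x * (G t x * \<eta> x))" if "t > 0" for t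
    by (rule Bochner_Integration.integrable_bound[OF integrable_mult_right[OF tail, of "2 * (1 + t)"]])
      (use bnd[OF that] in \<open>auto intro!: AE_I2 intro: order_trans[OF _ abs_ge_self]\<close>)
  have split: "(\<integral>x. indicator {0<..} x * (G t x * \<eta> x) \<partial>lborel) = N t + R t" if "t > 0" for t
    unfolding N_def R_def
    by (subst Bochner_Integration.integral_add[symmetric, OF near[OF that] far[OF that]])
      (use \<delta> Gg in \<open>auto simp: indicator_def intro!: Bochner_Integration.integral_cong\<close>)
  define T where "T = (\<integral>x. indicator {\<delta>..} x * \<eta> x \<partial>lborel)"
  have R: "\<bar>R t\<bar> \<le> 2 * T * (1 + t)" if "t > 0" for t
  proof -
    have "norm (R t) \<le> (\<integral>x. 2 * (1 + t) * (indicator {\<delta>..} x * \<eta> x) \<partial>lborel)"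
      unfolding R_def
      by (rule order_trans[OF integral_norm_bound integral_mono])
        (intro integrable_norm far integrable_mult_right tail bnd that)+
    also have "\<dots> = 2 * (1 + t) * T"
      unfolding T_def by (rule integral_mult_right_zero)
    finally show ?thesis by (simp add: mult_ac)
  qed
  have "((\<lambda>t. R t / (\<eta> (1 / t) / t)) \<longlongrightarrow> 0) at_top"
  proof (rule Lim_null_comparison)
    show "((\<lambda>t. 2 * T * ((1 + t) / (\<eta> (1 / t) / t))) \<longlongrightarrow> 0) at_top"
      by (intro tendsto_mult_right_zero regularly_varying_dominates_linear[OF assms(1) nn \<alpha>(1) lim])
    show "\<forall>\<^sub>F t in at_top. norm (R t / (\<eta> (1 / t) / t)) \<le> 2 * T * ((1 + t) / (\<eta> (1 / t) / t))"
      using eventually_gt_at_top[of 0]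
    proof eventually_elim
      case (elim t)
      have "\<bar>R t\<bar> / (\<eta> (1 / t) / t) \<le> 2 * T * (1 + t) / (\<eta> (1 / t) / t)"
        using R[OF elim] nn elim by (intro divide_right_mono) auto
      thus ?case using nn[of "1 / t"] elim by (simp add: abs_mult)
    qed
  qed
  hence "((\<lambda>t. (N t / (\<eta> (1 / t) / t) + R t / (\<eta> (1 / t) / t)) * ((\<eta> (1 / t) / t) / (t powr \<alpha> * K (1 / t))))
      \<longlongrightarrow> (?I + 0) * 1) at_top"
    using \<delta>(3) unfolding N_def[symmetric] by (intro tendsto_intros asymp_at_inverse(1)[OF \<eta>])
  \<comment> \<open>Needed to cancel the intermediate normaliser. A zero of \<open>\<eta>\<close>
    would make the quotient 0, contrary to its limit 1.\<close>
  moreover have "eventually (\<lambda>t. \<eta> (1 / t) \<noteq> 0) at_top"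
    using order_tendstoD(1)[OF asymp_at_inverse(1)[OF \<eta>] zero_less_one] by eventually_elim auto
  hence "eventually (\<lambda>t. (N t / (\<eta> (1 / t) / t) + R t / (\<eta> (1 / t) / t)) * ((\<eta> (1 / t) / t) / (t powr \<alpha> * K (1 / t)))
      = (\<integral>x. indicator {0<..} x * (G t x * \<eta> x) \<partial>lborel) / (t powr \<alpha> * K (1 / t))) at_top"
    using eventually_gt_at_top[of 0]
  proof eventually_elim
    case (elim t)
    have "(a / u + b / u) * (u / v) = (a + b) / v" if "u \<noteq> 0" for a b u v :: real
      using that by (simp flip: add_divide_distrib)
    from this[of "\<eta> (1 / t) / t"] show ?case using elim by (simp only: split divide_eq_0_iff) simp
  qed
  ultimately show ?thesis by (simp add: filterlim_cong)
qed

section \<open>The two kernels\<close>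

text \<open>Both functions are at most \<open>y\<^sup>2 / 2\<close>, by the half-angle formula and
  by the Maclaurin remainder, and at most \<open>2 * y\<close> for \<open>y > 1\<close>. The factor
  2 is a common crude constant.\<close>

lemma sin_diff_bounds:
  fixes y :: real
  assumes "y > 0"
  shows "\<bar>y - sin y\<bar> \<le> 2 * min y (y\<^sup>2)" "\<bar>1 - cos y\<bar> \<le> 2 * min y (y\<^sup>2)"
proof -
  have s: "\<bar>sin y\<bar> \<le> y" using abs_sin_x_le_abs_x[of y] assms by simp
  have c: "0 \<le> 1 - cos y" "1 - cos y \<le> y\<^sup>2 / 2"
  proof -
    have "\<bar>sin (y / 2)\<bar>\<^sup>2 \<le> \<bar>y / 2\<bar>\<^sup>2"
      by (intro power_mono abs_sin_x_le_abs_x) auto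
    moreover have "cos y = 1 - 2 * (sin (y / 2))\<^sup>2"
      using cos_double_sin[of "y / 2"] by simp
    ultimately show "1 - cos y \<le> y\<^sup>2 / 2" by (simp add: power_divide)
  qed simp
  show "\<bar>1 - cos y\<bar> \<le> 2 * min y (y\<^sup>2)"
  proof (cases "y \<le> 1")
    case True
    hence "y\<^sup>2 \<le> y" using assms by (simp add: power2_eq_square mult_left_le)
    hence "min y (y\<^sup>2) = y\<^sup>2" by simp
    moreover have "1 - cos y \<le> 2 * y\<^sup>2" using c(2) zero_le_power2[of y] by linarith
    ultimately show ?thesis using c(1) by simp
  next
    case False
    hence "min y (y\<^sup>2) = y" by (simp add: power2_eq_square)
    moreover have "1 - cos y \<le> 2 * y" using cos_ge_minus_one[of y] False by linarith
    ultimately show ?thesis using c(1) by simp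
  qed
  show "\<bar>y - sin y\<bar> \<le> 2 * min y (y\<^sup>2)"
  proof (cases "y \<le> 1")
    case True
    hence "y\<^sup>2 \<le> y" using assms by (simp add: power2_eq_square mult_left_le)
    \<comment> \<open>The partial sum over \<open>m < 2\<close> is just \<open>y\<close>, as the
      constant coefficient of the sine vanishes.\<close>
    have "\<bar>sin y - (\<Sum>m<2. sin_coeff m * y ^ m)\<bar> \<le> inverse (fact 2) * \<bar>y\<bar> ^ 2"
      by (rule Maclaurin_sin_bound)
    hence "\<bar>y - sin y\<bar> \<le> y\<^sup>2 / 2" by (simp add: sin_coeff_def numeral_2_eq_2 abs_minus_commute)
    moreover have "min y (y\<^sup>2) = y\<^sup>2" using \<open>y\<^sup>2 \<le> y\<close> by simp
    ultimately show ?thesis using zero_le_power2[of y] by linarith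
  next
    case False
    hence "1 * y \<le> y\<^sup>2" by (simp add: power2_eq_square)
    thus ?thesis using s False by auto
  qed
qed

lemma integrable_kernel:
  fixes g :: "real \<Rightarrow> real"
  assumes [measurable]: "g \<in> borel_measurable borel" and "1 < \<alpha>" "\<alpha> < 2"
    and g: "\<And>y. y > 0 \<Longrightarrow> \<bar>g y\<bar> \<le> 2 * min y (y\<^sup>2)"
  shows "integrable lborel (\<lambda>y. indicator {0<..} y * (g y * y powr (- \<alpha> - 1)))"
proof (rule Bochner_Integration.integrable_bound)
  show "integrable lborel (\<lambda>y. 2 * (indicator {0<..1} y * y powr (1 - \<alpha>) + indicator {1..} y * y powr (- \<alpha>)))"
    using assms by (intro integrable_mult_right integrable_powr_split) auto
  show "AE y in lborel. norm (indicator {0<..} y * (g y * y powr (- \<alpha> - 1)))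
    \<le> norm (2 * (indicator {0<..1} y * y powr (1 - \<alpha>) + indicator {1..} y * y powr (- \<alpha>)))"
  proof (rule AE_I2)
    fix y :: real
    have "\<bar>g y\<bar> * y powr (- \<alpha> - 1) \<le> 2 * (indicator {0<..1} y * y powr (1 - \<alpha>) + indicator {1..} y * y powr (- \<alpha>))"
      if "y > 0"
    proof (cases "y \<le> 1")
      case True
      have "\<bar>g y\<bar> * y powr (- \<alpha> - 1) \<le> (2 * y powr 2) * y powr (- \<alpha> - 1)"
        using g[OF that] that by (intro mult_right_mono) auto
      also have "\<dots> = 2 * y powr (1 - \<alpha>)" by (simp flip: powr_add)
      finally show ?thesis by (rule order_trans) (use that True in \<open>auto simp: indicator_def\<close>)
    next
      case False
      have "\<bar>g y\<bar> * y powr (- \<alpha> - 1) \<le> (2 * y powr 1) * y powr (- \<alpha> - 1)"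
        using g[OF that] that by (intro mult_right_mono) auto
      also have "\<dots> = 2 * y powr (- \<alpha>)" by (simp only: mult.assoc powr_add[symmetric]) simp
      finally show ?thesis by (rule order_trans) (use that False in \<open>auto simp: indicator_def\<close>)
    qed
    thus "norm (indicator {0<..} y * (g y * y powr (- \<alpha> - 1)))
      \<le> norm (2 * (indicator {0<..1} y * y powr (1 - \<alpha>) + indicator {1..} y * y powr (- \<alpha>)))"
      by (cases "y > 0") (auto simp: abs_mult intro: order_trans[OF _ abs_ge_self])
  qed
qed auto

text \<open>At infinity the bounded numerator is estimated by 2: for \<open>\<gamma>\<close> below
  2, the range used in the integration by parts, a linear estimate would leave a non-integrable
  power.\<close>

lemma integrable_cos_kernel:
  fixes \<gamma> :: real
  assumes "1 < \<gamma>" "\<gamma> < 3"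
  shows "set_integrable lborel {0<..} (\<lambda>x. (1 - cos x) / x powr \<gamma>)"
  unfolding set_integrable_def
proof (rule Bochner_Integration.integrable_bound)
  show "integrable lborel (\<lambda>y. 2 * (indicator {0<..1} y * y powr (2 - \<gamma>) + indicator {1..} y * y powr (- \<gamma>)))"
    using assms by (intro integrable_mult_right integrable_powr_split) auto
  show "AE y in lborel. norm (indicator {0<..} y *\<^sub>R ((1 - cos y) / y powr \<gamma>))
    \<le> norm (2 * (indicator {0<..1} y * y powr (2 - \<gamma>) + indicator {1..} y * y powr (- \<gamma>)))"
  proof (rule AE_I2)
    fix y :: real
    have "\<bar>(1 - cos y) / y powr \<gamma>\<bar> \<le> 2 * (indicator {0<..1} y * y powr (2 - \<gamma>) + indicator {1..} y * y powr (- \<gamma>))"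
      if "y > 0"
    proof (cases "y \<le> 1")
      case True
      have "\<bar>(1 - cos y) / y powr \<gamma>\<bar> \<le> (2 * y powr 2) / y powr \<gamma>"
        using sin_diff_bounds(2)[OF that] that by (auto simp: abs_divide intro!: divide_right_mono)
      also have "\<dots> = 2 * y powr (2 - \<gamma>)" by (simp add: powr_diff)
      finally show ?thesis by (rule order_trans) (use that True in \<open>auto simp: indicator_def\<close>)
    next
      case False
      have "\<bar>1 - cos y\<bar> \<le> 2" using cos_ge_minus_one[of y] cos_le_one[of y] by linarith
      hence "\<bar>(1 - cos y) / y powr \<gamma>\<bar> \<le> 2 / y powr \<gamma>"
        by (auto simp: abs_divide intro!: divide_right_mono)
      also have "\<dots> = 2 * y powr (- \<gamma>)" by (simp add: powr_minus divide_inverse)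
      finally show ?thesis by (rule order_trans) (use that False in \<open>auto simp: indicator_def\<close>)
    qed
    thus "norm (indicator {0<..} y *\<^sub>R ((1 - cos y) / y powr \<gamma>))
      \<le> norm (2 * (indicator {0<..1} y * y powr (2 - \<gamma>) + indicator {1..} y * y powr (- \<gamma>)))"
      by (cases "y > 0") (auto simp: abs_mult intro: order_trans[OF _ abs_ge_self])
  qed
qed auto

lemma integral_cos_kernel:
  "(\<integral>y. indicator {0<..} y * ((1 - cos y) * y powr (- \<alpha> - 1)) \<partial>lborel) = pi * C_const (\<alpha> + 1)"
proof -
  have "y powr (- \<alpha> - 1) = 1 / y powr (\<alpha> + 1)" for y :: real
    using powr_minus_divide[of y "\<alpha> + 1"] by simp
  thus ?thesis by (simp add: C_const_def set_lebesgue_integral_def)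
qed

lemma integral_sin_kernel:
  assumes "1 < \<alpha>" "\<alpha> < 2"
  shows "(\<integral>y. indicator {0<..} y * ((y - sin y) * y powr (- \<alpha> - 1)) \<partial>lborel) = pi * C_const \<alpha> / \<alpha>"
proof -
  define s where "s y = (y - sin y) * y powr (- \<alpha> - 1)" for y :: real
  define c where "c y = (1 - cos y) / y powr \<alpha>" for y :: real
  \<comment> \<open>The boundary term of the integration by parts, with derivative
    \<open>s y - c y / \<alpha>\<close>. It vanishes like \<open>y powr (3 - \<alpha>)\<close> at 0
    and like \<open>y powr (1 - \<alpha>)\<close> at infinity.\<close>
  define F where "F y = - (y - sin y) * y powr (- \<alpha>) / \<alpha>" for y :: real
  have int_s: "set_integrable lborel {0<..} s"
    using integrable_kernel[of "\<lambda>y. y - sin y" \<alpha>] sin_diff_bounds(1) assms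
    by (simp add: set_integrable_def s_def)
  have int_c: "set_integrable lborel {0<..} c"
    unfolding c_def using assms by (intro integrable_cos_kernel) auto
  have "\<alpha> \<noteq> 0" using assms by simp
  have "(LBINT y=ereal 0..\<infinity>. s y - c y / \<alpha>) = 0 - 0"
  proof (rule interval_integral_FTC_integrable)
    show "(F has_vector_derivative (s y - c y / \<alpha>)) (at y)" if "ereal 0 < ereal y" for y
    proof -
      have "(F has_real_derivative (s y - c y / \<alpha>)) (at y)"
        unfolding F_def s_def c_def using that \<open>\<alpha> \<noteq> 0\<close>
        by (auto intro!: derivative_eq_intros simp: powr_minus powr_diff field_simps)
      thus ?thesis by (simp add: has_real_derivative_iff_has_vector_derivative)
    qed
    show "isCont (\<lambda>y. s y - c y / \<alpha>) y" if "ereal 0 < ereal y" for y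
      unfolding s_def c_def using that \<open>\<alpha> \<noteq> 0\<close> by (intro continuous_intros) auto
    show "set_integrable lborel (einterval (ereal 0) \<infinity>) (\<lambda>y. s y - c y / \<alpha>)"
      using int_s int_c by (auto simp: einterval_eq intro!: set_integral_diff set_integrable_divide)
    have "((\<lambda>y. F y) \<longlongrightarrow> 0) (at_right 0)"
      unfolding F_def using assms by real_asymp
    thus "((F \<circ> real_of_ereal) \<longlongrightarrow> 0) (at_right (ereal 0))"
      by (simp add: ereal_tendsto_simps)
    have "((\<lambda>y. F y) \<longlongrightarrow> 0) at_top"
      unfolding F_def using assms by real_asymp
    thus "((F \<circ> real_of_ereal) \<longlongrightarrow> 0) (at_left \<infinity>)"
      by (simp add: ereal_tendsto_simps)
  qed simp
  hence "(LBINT y:{0<..}. s y - c y / \<alpha>) = 0"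
    unfolding interval_integral_to_infinity_eq by simp
  hence "(LBINT y:{0<..}. s y) = (LBINT y:{0<..}. c y) / \<alpha>"
    using int_s int_c by (simp add: set_integral_diff set_integrable_divide)
  thus ?thesis by (simp add: s_def c_def C_const_def set_lebesgue_integral_def)
qed

section \<open>Reduction of integrals over the line to the positive half-line\<close>

lemma integral_real_split:
  fixes f :: "real \<Rightarrow> real"
  assumes f: "integrable lborel f"
  shows "integral\<^sup>L lborel f =
    (\<integral>x. indicator {0<..} x * f x \<partial>lborel) + (\<integral>x. indicator {0<..} x * f (- x) \<partial>lborel)"
proof -
  have i: "integrable lborel (\<lambda>x. indicator A x * f x)" if "A \<in> sets borel" for A
    using integrable_mult_indicator[OF _ f, of A] that by simp
  have "integral\<^sup>L lborel f = (\<integral>x. indicator {0<..} x * f x + indicator {..<0} x * f x \<partial>lborel)"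
  proof (rule integral_cong_AE)
    show "AE x in lborel. f x = indicator {0<..} x * f x + indicator {..<0} x * f x"
      using AE_lborel_singleton[of 0] by eventually_elim (auto simp: indicator_def)
  qed (use f in auto)
  also have "\<dots> = (\<integral>x. indicator {0<..} x * f x \<partial>lborel) + (\<integral>x. indicator {..<0} x * f x \<partial>lborel)"
    by (intro Bochner_Integration.integral_add i) auto
  also have "(\<integral>x. indicator {..<0} x * f x \<partial>lborel) = (\<integral>x. indicator {..<0} (- x) * f (- x) \<partial>lborel)"
    using lborel_integral_real_affine[of "- 1" "\<lambda>x. indicator {..<0} x * f x" 0] by simp
  also have "\<dots> = (\<integral>x. indicator {0<..} x * f (- x) \<partial>lborel)"
    by (intro Bochner_Integration.integral_cong) (auto simp: indicator_def)
  finally show ?thesis .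
qed

lemma integrable_one_sided:
  fixes f :: "real \<Rightarrow> real"
  assumes "integrable lborel f"
  shows "integrable lborel (\<lambda>x. indicator {0<..} x * f x)"
    "integrable lborel (\<lambda>x. indicator {0<..} x * f (- x))"
proof -
  have r: "integrable lborel (\<lambda>x. f (- x))"
    using lborel_integrable_real_affine[OF assms, of "- 1" 0] by simp
  show "integrable lborel (\<lambda>x. indicator {0<..} x * f x)"
    "integrable lborel (\<lambda>x. indicator {0<..} x * f (- x))"
    using integrable_mult_indicator[OF _ assms, of "{0<..}"] integrable_mult_indicator[OF _ r, of "{0<..}"]
    by simp_all
qed

section \<open>Real and imaginary parts of the Levy-Khinchin integral for a measure with
  density\<close>

definition re_kernel :: "real \<Rightarrow> real \<Rightarrow> real" where
  "re_kernel t x = 1 - cos (t * x)"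

definition im_kernel :: "real \<Rightarrow> real \<Rightarrow> real" where
  "im_kernel t x = t * x * indicator {x. \<bar>x\<bar> < 1} x - sin (t * x)"

lemma kernels_measurable [measurable]:
  "re_kernel t \<in> borel_measurable borel" "im_kernel t \<in> borel_measurable borel"
  unfolding re_kernel_def[abs_def] im_kernel_def[abs_def] by measurable

text \<open>Serves integrability against the Levy measure for each fixed \<open>t\<close>:
  \<open>2 * t\<^sup>2\<close> handles \<open>\<bar>x\<bar> < 1\<close>, where the kernels are
  quadratic in \<open>t * x\<close>, and 2 handles the rest, where they are bounded.\<close>

lemma kernels_bound:
  "\<bar>re_kernel t x\<bar> \<le> (2 + 2 * t\<^sup>2) * min (x\<^sup>2) 1"
  "\<bar>im_kernel t x\<bar> \<le> (2 + 2 * t\<^sup>2) * min (x\<^sup>2) 1"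
proof -
  have *: "\<bar>1 - cos y\<bar> \<le> 2 * y\<^sup>2 \<and> \<bar>y - sin y\<bar> \<le> 2 * y\<^sup>2" for y :: real
    using sin_diff_bounds[of y] sin_diff_bounds[of "- y"] by (cases y "0::real" rule: linorder_cases) auto
  note b = *[of "t * x"]
  have le: "2 * (t * x)\<^sup>2 \<le> (2 + 2 * t\<^sup>2) * x\<^sup>2"
    by (simp add: power_mult_distrib distrib_right)
  have m: "min (x\<^sup>2) 1 = (if \<bar>x\<bar> < 1 then x\<^sup>2 else 1)"
    by (auto simp: min_def abs_square_le_1 abs_square_eq_1)
  show "\<bar>re_kernel t x\<bar> \<le> (2 + 2 * t\<^sup>2) * min (x\<^sup>2) 1"
  proof (cases "\<bar>x\<bar> < 1")
    case False
    have "\<bar>1 - cos (t * x)\<bar> \<le> 2" using cos_ge_minus_one[of "t * x"] cos_le_one[of "t * x"] by linarith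
    also have "2 \<le> 2 + 2 * t\<^sup>2" by simp
    finally show ?thesis unfolding m using False by (simp add: re_kernel_def)
  qed (unfold m, use b le in \<open>auto simp: re_kernel_def intro: order_trans\<close>)
  show "\<bar>im_kernel t x\<bar> \<le> (2 + 2 * t\<^sup>2) * min (x\<^sup>2) 1"
  proof (cases "\<bar>x\<bar> < 1")
    case False
    have "\<bar>sin (t * x)\<bar> \<le> 1" by simp
    also have "1 \<le> 2 + 2 * t\<^sup>2" using zero_le_power2[of t] by linarith
    finally show ?thesis unfolding m using False by (simp add: im_kernel_def)
  qed (unfold m, use b le in \<open>auto simp: im_kernel_def intro: order_trans\<close>)
qed

lemma integrable_levy_kernel:
  fixes \<xi> h :: "real \<Rightarrow> real"
  assumes [measurable]: "\<xi> \<in> borel_measurable borel" "h \<in> borel_measurable borel"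
    and nn: "\<And>x. 0 \<le> \<xi> x"
    and levy: "integrable lborel (\<lambda>x. min (x\<^sup>2) 1 * \<xi> x)"
    and h: "\<And>x. \<bar>h x\<bar> \<le> C * min (x\<^sup>2) 1"
  shows "integrable lborel (\<lambda>x. h x * \<xi> x)"
proof (rule Bochner_Integration.integrable_bound[OF integrable_mult_right[OF levy, of C]])
  show "AE x in lborel. norm (h x * \<xi> x) \<le> norm (C * (min (x\<^sup>2) 1 * \<xi> x))"
  proof (rule AE_I2)
    fix x
    have "\<bar>h x\<bar> * \<xi> x \<le> (C * min (x\<^sup>2) 1) * \<xi> x" by (intro mult_right_mono h nn)
    hence "norm (h x * \<xi> x) \<le> C * (min (x\<^sup>2) 1 * \<xi> x)"
      using nn[of x] by (simp add: abs_mult mult_ac)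
    thus "norm (h x * \<xi> x) \<le> norm (C * (min (x\<^sup>2) 1 * \<xi> x))"
      by simp
  qed
qed auto

text \<open>The complex integrand is \<open>re_kernel\<close> plus \<open>\<i>\<close> times
  \<open>im_kernel\<close>. Its integral may be separated because both parts are integrable, which
  follows from the Levy condition rewritten for Lebesgue measure.\<close>

lemma levy_khinchin_density:
  fixes \<xi> :: "real \<Rightarrow> real"
  assumes [measurable]: "\<xi> \<in> borel_measurable borel" and nn: "\<And>x. 0 \<le> \<xi> x"
    and levy: "levy_measure (density lborel (\<lambda>x. ennreal (\<xi> x)))"
  shows "integrable lborel (\<lambda>x. min (x\<^sup>2) 1 * \<xi> x)"
    "(\<integral>x. (1 - exp (\<i> * of_real (t * x)) + \<i> * of_real (t * x * indicator {x. \<bar>x\<bar> < 1} x))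
       \<partial>density lborel (\<lambda>x. ennreal (\<xi> x))) =
     Complex (\<integral>x. re_kernel t x * \<xi> x \<partial>lborel) (\<integral>x. im_kernel t x * \<xi> x \<partial>lborel)"
proof -
  have "(\<integral>\<^sup>+x. ennreal (\<xi> x) * ennreal (min (x\<^sup>2) 1) \<partial>lborel) < \<infinity>"
    using levy by (simp add: levy_measure_def nn_integral_density)
  also have "(\<integral>\<^sup>+x. ennreal (\<xi> x) * ennreal (min (x\<^sup>2) 1) \<partial>lborel) =
      (\<integral>\<^sup>+x. ennreal (min (x\<^sup>2) 1 * \<xi> x) \<partial>lborel)"
    using nn by (intro nn_integral_cong) (simp add: ennreal_mult mult.commute)
  finally show int: "integrable lborel (\<lambda>x. min (x\<^sup>2) 1 * \<xi> x)"
    using nn by (intro integrableI_nonneg) auto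
  have r: "integrable lborel (\<lambda>x. re_kernel t x * \<xi> x)"
    by (rule integrable_levy_kernel[OF _ _ nn int kernels_bound(1)]) auto
  have i: "integrable lborel (\<lambda>x. im_kernel t x * \<xi> x)"
    by (rule integrable_levy_kernel[OF _ _ nn int kernels_bound(2)]) auto
  have "(\<integral>x. (1 - exp (\<i> * of_real (t * x)) + \<i> * of_real (t * x * indicator {x. \<bar>x\<bar> < 1} x))
       \<partial>density lborel (\<lambda>x. ennreal (\<xi> x))) =
     (\<integral>x. \<xi> x *\<^sub>R (1 - exp (\<i> * of_real (t * x)) + \<i> * of_real (t * x * indicator {x. \<bar>x\<bar> < 1} x)) \<partial>lborel)"
    by (rule integral_density) (use nn in auto)
  also have "\<dots> = (\<integral>x. complex_of_real (re_kernel t x * \<xi> x) + \<i> * complex_of_real (im_kernel t x * \<xi> x) \<partial>lborel)"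
  proof (rule Bochner_Integration.integral_cong)
    fix x
    show "\<xi> x *\<^sub>R (1 - exp (\<i> * of_real (t * x)) + \<i> * of_real (t * x * indicator {x. \<bar>x\<bar> < 1} x)) =
      complex_of_real (re_kernel t x * \<xi> x) + \<i> * complex_of_real (im_kernel t x * \<xi> x)"
      by (rule complex_eqI) (simp_all add: re_kernel_def im_kernel_def Re_exp Im_exp algebra_simps)
  qed simp
  also have "\<dots> = complex_of_real (\<integral>x. re_kernel t x * \<xi> x \<partial>lborel) + \<i> * complex_of_real (\<integral>x. im_kernel t x * \<xi> x \<partial>lborel)"
    by (simp only: Bochner_Integration.integral_add integrable_of_real integrable_mult_right r i
        integral_of_real integral_mult_right_zero)
  finally show "(\<integral>x. (1 - exp (\<i> * of_real (t * x)) + \<i> * of_real (t * x * indicator {x. \<bar>x\<bar> < 1} x))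
       \<partial>density lborel (\<lambda>x. ennreal (\<xi> x))) =
     Complex (\<integral>x. re_kernel t x * \<xi> x \<partial>lborel) (\<integral>x. im_kernel t x * \<xi> x \<partial>lborel)"
    by (simp add: Complex_eq)
qed

section \<open>Combining the two halves\<close>

text \<open>The share of \<open>P\<close> equals \<open>1 / (1 + Q / P)\<close>, which converges
  also when the ratio diverges. Passing from ratios to shares lets later limits be taken once for
  finite and infinite \<open>k\<close>.\<close>

lemma tendsto_weights:
  fixes P Q :: "'b \<Rightarrow> real" and k :: ereal
  assumes pos: "eventually (\<lambda>t. P t > 0) F" "eventually (\<lambda>t. Q t > 0) F"
    and "0 \<le> k" and k: "((\<lambda>t. ereal (Q t / P t)) \<longlongrightarrow> k) F"
  defines "p \<equiv> (if k = \<infinity> then 0 else 1 / (1 + real_of_ereal k))"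
  shows "((\<lambda>t. P t / (P t + Q t)) \<longlongrightarrow> p) F" "((\<lambda>t. Q t / (P t + Q t)) \<longlongrightarrow> 1 - p) F"
proof -
  have "((\<lambda>t. 1 / (1 + Q t / P t)) \<longlongrightarrow> p) F"
  proof (cases k)
    case (real r)
    hence "((\<lambda>t. Q t / P t) \<longlongrightarrow> r) F" "r \<ge> 0" using k \<open>0 \<le> k\<close> by auto
    thus ?thesis using real by (auto simp: p_def intro!: tendsto_intros)
  next
    case PInf
    hence "filterlim (\<lambda>t. Q t / P t) at_top F" using k by (simp add: tendsto_PInfty_eq_at_top)
    hence "filterlim (\<lambda>t. 1 + Q t / P t) at_top F"
      by (intro filterlim_tendsto_add_at_top[OF tendsto_const])
    hence "((\<lambda>t. 1 / (1 + Q t / P t)) \<longlongrightarrow> 0) F"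
      by (intro real_tendsto_divide_at_top[OF tendsto_const])
    thus ?thesis using PInf by (simp add: p_def)
  qed (use \<open>0 \<le> k\<close> in auto)
  moreover have "eventually (\<lambda>t. 1 / (1 + Q t / P t) = P t / (P t + Q t)) F"
    using pos by eventually_elim (auto simp: field_simps)
  ultimately show P: "((\<lambda>t. P t / (P t + Q t)) \<longlongrightarrow> p) F" by (simp add: filterlim_cong)
  have "eventually (\<lambda>t. 1 - P t / (P t + Q t) = Q t / (P t + Q t)) F"
    using pos by eventually_elim (auto simp: field_simps)
  moreover have "((\<lambda>t. 1 - P t / (P t + Q t)) \<longlongrightarrow> 1 - p) F"
    by (intro tendsto_intros P)
  ultimately show "((\<lambda>t. Q t / (P t + Q t)) \<longlongrightarrow> 1 - p) F" by (simp add: filterlim_cong)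
qed

text \<open>Each half comes with its own normaliser; rescaling by the shares turns the sum into a
  weighted mean of the two limits. The common factor \<open>s\<close> is a power of \<open>t\<close>
  for the exponent and the constant 1 for the slow variation of \<open>L\<close>.\<close>

lemma tendsto_weighted_sum:
  fixes A B P Q s :: "'b \<Rightarrow> real"
  assumes "eventually (\<lambda>t. P t > 0) F" "eventually (\<lambda>t. Q t > 0) F"
    and "((\<lambda>t. A t / (s t * P t)) \<longlongrightarrow> c) F" "((\<lambda>t. B t / (s t * Q t)) \<longlongrightarrow> d) F"
    and "((\<lambda>t. P t / (P t + Q t)) \<longlongrightarrow> p) F" "((\<lambda>t. Q t / (P t + Q t)) \<longlongrightarrow> q) F"
  shows "((\<lambda>t. (A t + B t) / (s t * (P t + Q t))) \<longlongrightarrow> c * p + d * q) F"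
proof -
  have "((\<lambda>t. A t / (s t * P t) * (P t / (P t + Q t)) + B t / (s t * Q t) * (Q t / (P t + Q t)))
      \<longlongrightarrow> c * p + d * q) F"
    by (intro tendsto_intros assms)
  moreover have "eventually (\<lambda>t. A t / (s t * P t) * (P t / (P t + Q t)) + B t / (s t * Q t) * (Q t / (P t + Q t))
      = (A t + B t) / (s t * (P t + Q t))) F"
    using assms(1,2) by eventually_elim (simp add: add_divide_distrib)
  ultimately show ?thesis by (simp add: filterlim_cong)
qed

theorem theorem1p3:
  fixes M :: "'a measure" and X :: "real \<Rightarrow> 'a \<Rightarrow> real"
    and a b \<alpha> :: real and \<nu> :: "real measure" and \<Psi> :: "real \<Rightarrow> complex"
    and \<xi> K\<^sub>p K\<^sub>m :: "real \<Rightarrow> real" and k :: ereal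
  assumes "levy_process M X"
    and "levy_khinchin_exponent M X a b \<nu> \<Psi>"
    and "\<xi> \<in> borel_measurable borel" and "\<And>x. 0 \<le> \<xi> x"
    and "\<nu> = density lborel (\<lambda>x. ennreal (\<xi> x))"
    and "a = 0"
    and "1 < \<alpha>" and "\<alpha> < 2"
    and "slowly_varying (at_right 0) K\<^sub>p" and "slowly_varying (at_right 0) K\<^sub>m"
    and "0 \<le> k" and "((\<lambda>x. ereal (K\<^sub>m x / K\<^sub>p x)) \<longlongrightarrow> k) (at_right 0)"
    and "asymp_mult (at_right 0) (\<lambda>x. \<xi> x) 1 (\<lambda>x. x powr (- \<alpha> - 1) * K\<^sub>p x)"
    and "asymp_mult (at_right 0) (\<lambda>x. \<xi> (- x)) 1 (\<lambda>x. x powr (- \<alpha> - 1) * K\<^sub>m x)"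
  shows
    "let L = (\<lambda>t. K\<^sub>p (1 / t) + K\<^sub>m (1 / t));
         r = (if k = \<infinity> then - 1 else (1 - real_of_ereal k) / (1 + real_of_ereal k));
         c_theta = pi * C_const (\<alpha> + 1);
         c_omega = r * (pi * C_const \<alpha> / \<alpha>)
     in asymp_mult at_top (\<lambda>t. Re (\<Psi> t)) c_theta (\<lambda>t. t powr \<alpha> * L t) \<and>
        asymp_mult at_top (\<lambda>t. Im (\<Psi> t)) c_omega (\<lambda>t. t powr \<alpha> * L t) \<and>
        slowly_varying at_top L \<and>
        (k \<noteq> \<infinity> \<longrightarrow> asymp_mult at_top L (1 + real_of_ereal k) (\<lambda>t. K\<^sub>p (1 / t))) \<and>
        (k = \<infinity> \<longrightarrow> asymp_mult at_top L 1 (\<lambda>t. K\<^sub>m (1 / t)))"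
proof -
  define L where "L t = K\<^sub>p (1 / t) + K\<^sub>m (1 / t)" for t
  \<comment> \<open>The limiting share of the positive half in \<open>L\<close>.\<close>
  define p where "p = (if k = \<infinity> then 0 else 1 / (1 + real_of_ereal k))"
  note \<alpha> = \<open>1 < \<alpha>\<close> \<open>\<alpha> < 2\<close>
  have [measurable]: "\<xi> \<in> borel_measurable borel" by fact
  have nn: "0 \<le> \<xi> x" "0 \<le> \<xi> (- x)" for x using assms(4) by auto
  have \<nu>: "levy_measure (density lborel (\<lambda>x. ennreal (\<xi> x)))"
    using assms(2,5) by (simp add: levy_khinchin_exponent_def)
  note levy = levy_khinchin_density(1)[OF assms(3,4) \<nu>]
  have \<Psi>: "\<Psi> t = \<i> * of_real (b * t) +
      Complex (\<integral>x. re_kernel t x * \<xi> x \<partial>lborel) (\<integral>x. im_kernel t x * \<xi> x \<partial>lborel)" for t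
    using assms(2,5,6) levy_khinchin_density(2)[OF assms(3,4) \<nu>, of t]
    by (simp add: levy_khinchin_exponent_def)
  have int: "integrable lborel (\<lambda>x. re_kernel t x * \<xi> x)" "integrable lborel (\<lambda>x. im_kernel t x * \<xi> x)" for t
    by (rule integrable_levy_kernel[OF _ _ nn(1) levy kernels_bound(1)]
        integrable_levy_kernel[OF _ _ nn(1) levy kernels_bound(2)], measurable)+
  define A where "A \<eta> t = (\<integral>x. indicator {0<..} x * (re_kernel t x * \<eta> x) \<partial>lborel)" for \<eta> :: "real \<Rightarrow> real" and t
  define B where "B \<eta> t = (\<integral>x. indicator {0<..} x * (im_kernel t x * \<eta> x) \<partial>lborel)" for \<eta> :: "real \<Rightarrow> real" and t
  have Re: "Re (\<Psi> t) = A \<xi> t + A (\<lambda>x. \<xi> (- x)) t" for t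
  proof -
    have "re_kernel t (- x) = re_kernel t x" for x by (simp add: re_kernel_def)
    thus ?thesis unfolding A_def by (simp add: \<Psi> integral_real_split[OF int(1)])
  qed
  \<comment> \<open>The imaginary kernel is odd, hence the minus sign. The drift is grouped with the
    positive half; it is negligible against \<open>t powr \<alpha> * K\<^sub>p (1 / t)\<close>,
    whatever the value of \<open>k\<close>.\<close>
  have Im: "Im (\<Psi> t) = (b * t + B \<xi> t) + - B (\<lambda>x. \<xi> (- x)) t" for t
  proof -
    have "(\<integral>x. indicator {0<..} x * (im_kernel t (- x) * \<xi> (- x)) \<partial>lborel) = - B (\<lambda>x. \<xi> (- x)) t"
      unfolding B_def by (subst Bochner_Integration.integral_minus[symmetric])
        (auto simp: im_kernel_def indicator_def algebra_simps intro!: Bochner_Integration.integral_cong)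
    thus ?thesis unfolding B_def by (simp add: \<Psi> integral_real_split[OF int(2)])
  qed
  \<comment> \<open>Kept general in \<open>\<eta>\<close> and \<open>K\<close>, to be applied to
    \<open>\<xi>\<close> with \<open>K\<^sub>p\<close> and to its reflection with
    \<open>K\<^sub>m\<close>.\<close>
  have re: "((\<lambda>t. A \<eta> t / (t powr \<alpha> * K (1 / t))) \<longlongrightarrow> pi * C_const (\<alpha> + 1)) at_top"
    and im: "((\<lambda>t. B \<eta> t / (t powr \<alpha> * K (1 / t))) \<longlongrightarrow> pi * C_const \<alpha> / \<alpha>) at_top"
    if [measurable]: "\<eta> \<in> borel_measurable borel" and nn: "\<And>x. 0 \<le> \<eta> x"
      and levy: "integrable lborel (\<lambda>x. indicator {0<..} x * (min (x\<^sup>2) 1 * \<eta> x))"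
      and K: "slowly_varying (at_right 0) K" "asymp_mult (at_right 0) \<eta> 1 (\<lambda>x. x powr (- \<alpha> - 1) * K x)"
    for \<eta> K
  proof -
    show "((\<lambda>t. A \<eta> t / (t powr \<alpha> * K (1 / t))) \<longlongrightarrow> pi * C_const (\<alpha> + 1)) at_top"
      unfolding A_def integral_cos_kernel[symmetric]
    proof (rule one_sided_integral_asymp[OF _ _ _ nn \<alpha> K levy])
      fix t x :: real assume "0 < t" "0 < x"
      have "\<bar>re_kernel t x\<bar> \<le> 2"
        unfolding re_kernel_def using cos_ge_minus_one[of "t * x"] cos_le_one[of "t * x"] by linarith
      thus "\<bar>re_kernel t x\<bar> \<le> 2 * (1 + t)" using \<open>0 < t\<close> by simp
    qed (use sin_diff_bounds in \<open>auto simp: re_kernel_def\<close>)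
    show "((\<lambda>t. B \<eta> t / (t powr \<alpha> * K (1 / t))) \<longlongrightarrow> pi * C_const \<alpha> / \<alpha>) at_top"
      unfolding B_def integral_sin_kernel[OF \<alpha>, symmetric]
    proof (rule one_sided_integral_asymp[OF _ _ _ nn \<alpha> K levy])
      fix t x :: real assume *: "0 < t" "0 < x"
      have "\<bar>t * x * indicator {x. \<bar>x\<bar> < 1} x\<bar> \<le> t"
        using * by (auto simp: indicator_def mult_left_le)
      from add_mono[OF this abs_sin_le_one[of "t * x"]] show "\<bar>im_kernel t x\<bar> \<le> 2 * (1 + t)"
        unfolding im_kernel_def using * by (intro order_trans[OF abs_triangle_ineq4]) auto
    qed (use sin_diff_bounds in \<open>auto simp: im_kernel_def\<close>)
  qed
  have levy2: "integrable lborel (\<lambda>x. indicator {0<..} x * (min (x\<^sup>2) 1 * \<xi> x))"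
      "integrable lborel (\<lambda>x. indicator {0<..} x * (min (x\<^sup>2) 1 * \<xi> (- x)))"
    using integrable_one_sided[OF levy] by simp_all
  note rep = re[OF assms(3) nn(1) levy2(1) assms(9,13)] and imp = im[OF assms(3) nn(1) levy2(1) assms(9,13)]
  have [measurable]: "(\<lambda>x. \<xi> (- x)) \<in> borel_measurable borel" by measurable
  note rem = re[OF this nn(2) levy2(2) assms(10,14)] and imm = im[OF this nn(2) levy2(2) assms(10,14)]
  have pos: "eventually (\<lambda>t. K\<^sub>p (1 / t) > 0) at_top" "eventually (\<lambda>t. K\<^sub>m (1 / t) > 0) at_top"
    using asymp_at_inverse(2)[OF assms(13)] asymp_at_inverse(2)[OF assms(14)] eventually_gt_at_top[of 0]
    by (eventually_elim, use assms(9,10) in \<open>force simp: slowly_varying_def order.strict_iff_order\<close>)+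
  have inv: "filterlim (\<lambda>t::real. 1 / t) (at_right 0) at_top" by real_asymp
  have k_lim: "((\<lambda>t. ereal (K\<^sub>m (1 / t) / K\<^sub>p (1 / t))) \<longlongrightarrow> k) at_top"
    by (rule filterlim_compose[OF assms(12) inv])
  note w = tendsto_weights[OF pos \<open>0 \<le> k\<close> k_lim, folded p_def]
  have drift: "((\<lambda>t. b * t / (t powr \<alpha> * K\<^sub>p (1 / t))) \<longlongrightarrow> 0) at_top"
  proof -
    \<comment> \<open>A telescoping product: the third factor tends to 0 because the density
      dominates linear growth, and the last one changes the normaliser to
      \<open>K\<^sub>p\<close>.\<close>
    have "((\<lambda>t. b * (t / (1 + t)) * ((1 + t) / (\<xi> (1 / t) / t)) *
        ((\<xi> (1 / t) / t) / (t powr \<alpha> * K\<^sub>p (1 / t)))) \<longlongrightarrow> b * 1 * 0 * 1) at_top"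
      by (intro tendsto_intros regularly_varying_dominates_linear[OF assms(3,4) \<alpha>(1)]
          regularly_varying_of_asymp[OF assms(9,13)] asymp_at_inverse(1)[OF assms(13)]) real_asymp
    moreover have "eventually (\<lambda>t. \<xi> (1 / t) \<noteq> 0) at_top"
      using order_tendstoD(1)[OF asymp_at_inverse(1)[OF assms(13)] zero_less_one] by eventually_elim auto
    hence "eventually (\<lambda>t. b * (t / (1 + t)) * ((1 + t) / (\<xi> (1 / t) / t)) *
        ((\<xi> (1 / t) / t) / (t powr \<alpha> * K\<^sub>p (1 / t))) = b * t / (t powr \<alpha> * K\<^sub>p (1 / t))) at_top"
      using eventually_gt_at_top[of 0] by eventually_elim simp
    ultimately show ?thesis by (simp add: filterlim_cong)
  qed
  have nz: "eventually (\<lambda>t. t powr \<alpha> * L t \<noteq> 0) at_top"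
    using pos eventually_gt_at_top[of 0] by eventually_elim (auto simp: L_def)
  \<comment> \<open>Both halves contribute the same constant and the shares add up to 1, so the
    limit is independent of \<open>k\<close>.\<close>
  have "((\<lambda>t. Re (\<Psi> t) / (t powr \<alpha> * L t)) \<longlongrightarrow>
      pi * C_const (\<alpha> + 1) * p + pi * C_const (\<alpha> + 1) * (1 - p)) at_top"
    unfolding Re L_def by (rule tendsto_weighted_sum[OF pos rep rem w])
  hence 1: "asymp_mult at_top (\<lambda>t. Re (\<Psi> t)) (pi * C_const (\<alpha> + 1)) (\<lambda>t. t powr \<alpha> * L t)"
    using nz by (simp add: asymp_mult_def algebra_simps)
  have "((\<lambda>t. (b * t + B \<xi> t) / (t powr \<alpha> * K\<^sub>p (1 / t))) \<longlongrightarrow> 0 + pi * C_const \<alpha> / \<alpha>) at_top"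
    unfolding add_divide_distrib by (intro tendsto_add drift imp)
  moreover have "((\<lambda>t. - B (\<lambda>x. \<xi> (- x)) t / (t powr \<alpha> * K\<^sub>m (1 / t))) \<longlongrightarrow> - (pi * C_const \<alpha> / \<alpha>)) at_top"
    unfolding minus_divide_left[symmetric] by (intro tendsto_minus imm)
  ultimately have "((\<lambda>t. Im (\<Psi> t) / (t powr \<alpha> * L t)) \<longlongrightarrow>
      (0 + pi * C_const \<alpha> / \<alpha>) * p + - (pi * C_const \<alpha> / \<alpha>) * (1 - p)) at_top"
    unfolding Im L_def by (rule tendsto_weighted_sum[OF pos _ _ w])
  also have "(0 + pi * C_const \<alpha> / \<alpha>) * p + - (pi * C_const \<alpha> / \<alpha>) * (1 - p) =
      (2 * p - 1) * (pi * C_const \<alpha> / \<alpha>)"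
    by (simp only: algebra_simps) simp
  \<comment> \<open>The opposite signs of the halves leave the difference of the shares
    \<open>p\<close> and \<open>1 - p\<close>; for \<open>k = \<infinity>\<close> the share
    \<open>p\<close> is 0, which gives the value -1.\<close>
  also have "2 * p - 1 = (if k = \<infinity> then - 1 else (1 - real_of_ereal k) / (1 + real_of_ereal k))"
    using \<open>0 \<le> k\<close> by (cases k) (auto simp: p_def field_simps)
  finally have 2: "asymp_mult at_top (\<lambda>t. Im (\<Psi> t))
      ((if k = \<infinity> then - 1 else (1 - real_of_ereal k) / (1 + real_of_ereal k)) * (pi * C_const \<alpha> / \<alpha>))
      (\<lambda>t. t powr \<alpha> * L t)"
    using nz by (simp add: asymp_mult_def)
  have 3: "slowly_varying at_top L"
    unfolding slowly_varying_def
  proof (intro conjI allI impI)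
    show "0 \<le> L x" if "x > 0" for x
      using assms(9,10) that by (simp add: L_def slowly_varying_def)
    show "((\<lambda>t. L (c * t) / L t) \<longlongrightarrow> 1) at_top" if "c > 0" for c
    proof -
      \<comment> \<open>Slow variation at 0 with the constant \<open>1 / c\<close>. The factor 1 in
        the denominator gives the shape of \<open>tendsto_weighted_sum\<close> with \<open>s\<close>
        constantly 1.\<close>
      have scale: "((\<lambda>t. K (1 / (c * t)) / (1 * K (1 / t))) \<longlongrightarrow> 1) at_top"
        if "slowly_varying (at_right 0) K" for K
      proof -
        have "((\<lambda>x. K (1 / c * x) / K x) \<longlongrightarrow> 1) (at_right 0)"
          using that \<open>c > 0\<close> by (simp add: slowly_varying_def del: times_divide_eq_left)
        from filterlim_compose[OF this inv] show ?thesis by simp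
      qed
      have "((\<lambda>t. L (c * t) / (1 * (K\<^sub>p (1 / t) + K\<^sub>m (1 / t)))) \<longlongrightarrow> 1 * p + 1 * (1 - p)) at_top"
        unfolding L_def by (rule tendsto_weighted_sum[OF pos scale scale w]) fact+
      thus ?thesis by (simp add: L_def)
    qed
  qed
  have 4: "asymp_mult at_top L (1 + real_of_ereal k) (\<lambda>t. K\<^sub>p (1 / t))" if "k \<noteq> \<infinity>"
  proof -
    have "((\<lambda>t. K\<^sub>m (1 / t) / K\<^sub>p (1 / t)) \<longlongrightarrow> real_of_ereal k) at_top"
      using k_lim that \<open>0 \<le> k\<close> by (cases k) auto
    hence "((\<lambda>t. 1 + K\<^sub>m (1 / t) / K\<^sub>p (1 / t)) \<longlongrightarrow> 1 + real_of_ereal k) at_top"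
      by (intro tendsto_intros)
    moreover have "eventually (\<lambda>t. 1 + K\<^sub>m (1 / t) / K\<^sub>p (1 / t) = L t / K\<^sub>p (1 / t)) at_top"
      using pos(1) by eventually_elim (simp add: L_def field_simps)
    ultimately show ?thesis
      using pos(1) by (auto simp: asymp_mult_def filterlim_cong elim: eventually_mono)
  qed
  have 5: "asymp_mult at_top L 1 (\<lambda>t. K\<^sub>m (1 / t))" if "k = \<infinity>"
  proof -
    \<comment> \<open>The inner quotient is the share of the negative half, which tends to
      \<open>1 - p\<close> with \<open>p = 0\<close>; its reciprocal is the ratio wanted.\<close>
    have "((\<lambda>t. 1 / (K\<^sub>m (1 / t) / L t)) \<longlongrightarrow> 1 / (1 - 0)) at_top"
      using w(2) that by (intro tendsto_intros) (auto simp: p_def L_def)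
    thus ?thesis
      using pos(2) by (auto simp: asymp_mult_def elim: eventually_mono)
  qed
  show ?thesis
    using 1 2 3 4 5 unfolding Let_def L_def by blast
qed

end
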